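(* For all $\varepsilon\in(0,1]$, every deterministic $\varepsilon$-clairvoyant algorithm has competitive ratio at least $\lceil 1/\varepsilon\rceil$ for the objective of minimizing total flow time on a single machine. Moreover, every randomized $\varepsilon$-clairvoyant algorithm has competitive ratio $\Omega(1/\varepsilon)$.
   Context: Single-machine preemptive online scheduling: jobs $j$ with release times $q_j\ge0$ and processing times $p_j>0$ arrive over time; at most one job processed at any instant; preemption allowed; objective total flow time $\sum_j (C_j-q_j)$ where $C_j$ is the completion time. In the $\varepsilon$-clairvoyant model, $p_j$ is unknown when $j$ arrives and is revealed to the algorithm once the remaining processing time of $j$ is at most $\varepsilon p_j$. A (randomized) algorithm is $\rho$-competitive if on every instance its (expected) total flow time is at most $\rho$ times the optimal total flow time; its competitive ratio is the smallest such $\rho$. *)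

theory Defs
  imports "HOL-Probability.Probability"
begin

record sched_instance =
  jobs :: "nat set"
  release :: "nat \<Rightarrow> real"
  proc_time :: "nat \<Rightarrow> real"

definition valid_instance :: "sched_instance \<Rightarrow> bool" where
  "valid_instance I \<longleftrightarrow> finite (jobs I) \<and>
     (\<forall>j\<in>jobs I. 0 \<le> release I j \<and> 0 < proc_time I j)"

text \<open>A preemptive single-machine schedule assigns to every instant the job being processed,
  or \<open>None\<close> if the machine idles.\<close>

type_synonym schedule = "real \<Rightarrow> nat option"

definition valid_schedule :: "sched_instance \<Rightarrow> schedule \<Rightarrow> bool" where
  "valid_schedule I S \<longleftrightarrow>
     (\<forall>j. {t. S t = Some j} \<in> sets lebesgue) \<and>
     (\<forall>t j. S t = Some j \<longrightarrow> j \<in> jobs I \<and> release I j \<le> t)"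

definition processed :: "schedule \<Rightarrow> nat \<Rightarrow> real \<Rightarrow> real" where
  "processed S j t = measure lebesgue {s \<in> {0..t}. S s = Some j}"

text \<open>Costs are extended nonnegative reals: a job that is never finished has completion
  time \<open>\<infinity>\<close> (the infimum of the empty set).\<close>

definition completion_time :: "sched_instance \<Rightarrow> schedule \<Rightarrow> nat \<Rightarrow> ennreal" where
  "completion_time I S j = Inf (ennreal ` {t. 0 \<le> t \<and> proc_time I j \<le> processed S j t})"

definition total_flow_time :: "sched_instance \<Rightarrow> schedule \<Rightarrow> ennreal" where
  "total_flow_time I S = (\<Sum>j\<in>jobs I. completion_time I S j - ennreal (release I j))"

definition opt_flow_time :: "sched_instance \<Rightarrow> ennreal" where
  "opt_flow_time I = Inf {total_flow_time I S | S. valid_schedule I S}"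

definition released_info :: "sched_instance \<Rightarrow> real \<Rightarrow> (nat \<times> real) set" where
  "released_info I t = {(j, release I j) | j. j \<in> jobs I \<and> release I j \<le> t}"

definition revealed_info :: "real \<Rightarrow> sched_instance \<Rightarrow> schedule \<Rightarrow> real \<Rightarrow> (nat \<times> real) set" where
  "revealed_info \<epsilon> I S t =
     {(j, proc_time I j) | j. j \<in> jobs I \<and> release I j \<le> t \<and>
        proc_time I j - processed S j t \<le> \<epsilon> * proc_time I j}"

text \<open>An online algorithm is a map from instances to schedules whose decision at time \<open>t\<close>
  depends only on what has been observed during \<open>[0,t]\<close>. The algorithm's own past decisions
  are deliberately not part of the premise: they are themselves determined by the past
  observations, and in continuous time assuming that they agree would allow two
  runs to diverge without any difference in the observations.\<close>

type_synonym algorithm = "sched_instance \<Rightarrow> schedule"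

definition clairvoyant_algorithm :: "real \<Rightarrow> algorithm \<Rightarrow> bool" where
  "clairvoyant_algorithm \<epsilon> A \<longleftrightarrow>
     (\<forall>I. valid_instance I \<longrightarrow> valid_schedule I (A I)) \<and>
     (\<forall>I I' t. valid_instance I \<and> valid_instance I' \<and> 0 \<le> t \<and>
        (\<forall>s\<in>{0..t}. released_info I s = released_info I' s \<and>
                     revealed_info \<epsilon> I (A I) s = revealed_info \<epsilon> I' (A I') s)
        \<longrightarrow> A I t = A I' t)"

text \<open>A randomized algorithm is a probability distribution over deterministic ones. The
  \<sigma>-algebra is arbitrary, as long as the expected total flow time is defined; a family of
  deterministic algorithms indexed by any probability space induces such a distribution.\<close>

definition randomized_clairvoyant_algorithm :: "real \<Rightarrow> algorithm measure \<Rightarrow> bool" where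
  "randomized_clairvoyant_algorithm \<epsilon> M \<longleftrightarrow>
     prob_space M \<and>
     (\<forall>A\<in>space M. clairvoyant_algorithm \<epsilon> A) \<and>
     (\<forall>I. valid_instance I \<longrightarrow> (\<lambda>A. total_flow_time I (A I)) \<in> borel_measurable M)"

definition algorithm_cost :: "algorithm \<Rightarrow> sched_instance \<Rightarrow> ennreal" where
  "algorithm_cost A I = total_flow_time I (A I)"

definition expected_cost :: "algorithm measure \<Rightarrow> sched_instance \<Rightarrow> ennreal" where
  "expected_cost M I = (\<integral>\<^sup>+ A. total_flow_time I (A I) \<partial>M)"

definition competitive :: "ennreal \<Rightarrow> (sched_instance \<Rightarrow> ennreal) \<Rightarrow> bool" where
  "competitive \<rho> cost \<longleftrightarrow> (\<forall>I. valid_instance I \<longrightarrow> cost I \<le> \<rho> * opt_flow_time I)"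

definition competitive_ratio :: "(sched_instance \<Rightarrow> ennreal) \<Rightarrow> ennreal" where
  "competitive_ratio cost = Inf {\<rho>. competitive \<rho> cost}"

end

theory Submission
  imports Defs
begin

text \<open>Both bounds use the same ending: at some time \<open>\<tau>\<close> the algorithm has many unfinished jobs and the
  optimum only few, and then a long stream of equal small jobs arrives, one per job length. Finishing
  an old job during the stream leaves at least as many stream jobs waiting, so the ratio of the flow
  times tends to the ratio of the numbers of unfinished jobs, up to one stream job on the side of the
  optimum.

  Deterministic case, with \<open>k = \<lceil>1 / \<epsilon>\<rceil>\<close>: release \<open>k\<close> jobs that look endless, wait for time \<open>T\<close>, and let
  \<open>x j\<close> be the work done on job \<open>j\<close>. The job with the largest \<open>x j\<close> stays endless, every other one gets size
  \<open>x j + c\<close> with \<open>c\<close> just above \<open>(Max x) * \<epsilon> / (1 - \<epsilon>)\<close>, so that nothing has been revealed. As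
  \<open>(k - 1) * \<epsilon> < 1\<close>, the \<open>k - 1\<close> finite jobs fit into a time shorter than \<open>T + c\<close>, before which the
  algorithm cannot finish anything. Repeating this on ever smaller time scales gives \<open>k * m\<close>
  unfinished jobs against \<open>m\<close>.

  Randomized case, by averaging over random instances: \<open>n\<close> jobs with independent sizes on
  \<open>{1..r + 1}\<close>, \<open>r = \<lfloor>1 / \<epsilon>\<rfloor>\<close>, whose law makes the expected number of completions at most half the
  expected work, whichever revealed jobs the algorithm completes. This is seen by resampling the size
  of a single job. A fraction \<open>Q\<close> of the jobs has the maximal size;
  the optimum finishes all others by time \<open>n * (2 - r * Q)\<close>, when the algorithm still has
  \<open>n * r * Q / 2\<close> unfinished jobs in expectation.\<close>

section \<open>Work done by a schedule, and indistinguishable instances\<close>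

lemma job_slots_lmeasurable:
  assumes "valid_schedule I S" "X \<in> lmeasurable"
  shows "{s \<in> X. S s = Some j} \<in> lmeasurable"
proof -
  have "X \<inter> {s. S s = Some j} \<in> lmeasurable"
    using assms by (intro fmeasurable_Int_fmeasurable) (auto simp: valid_schedule_def)
  then show ?thesis by (simp add: Int_def)
qed

lemma half_open_lmeasurable: "{a<..b::real} \<in> lmeasurable"
  by (rule bounded_set_imp_lmeasurable) auto

lemma job_slots_emeasure_finite:
  assumes "valid_schedule I S" "X \<in> lmeasurable"
  shows "emeasure lebesgue {s \<in> X. S s = Some j} \<noteq> \<infinity>"
  using fmeasurableD2[OF job_slots_lmeasurable[OF assms]] by simp

lemma processed_diff:
  assumes S: "valid_schedule I S" and "0 \<le> u" "u \<le> t"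
  shows "processed S j t - processed S j u = measure lebesgue {s \<in> {u<..t}. S s = Some j}"
proof -
  have "{s \<in> {0..t}. S s = Some j} = {s \<in> {0..u}. S s = Some j} \<union> {s \<in> {u<..t}. S s = Some j}"
    using assms by auto
  moreover have "measure lebesgue ({s \<in> {0..u}. S s = Some j} \<union> {s \<in> {u<..t}. S s = Some j})
     = measure lebesgue {s \<in> {0..u}. S s = Some j} + measure lebesgue {s \<in> {u<..t}. S s = Some j}"
    by (intro measure_Union job_slots_emeasure_finite[OF S] fmeasurableD job_slots_lmeasurable[OF S]
          lmeasurable_interval half_open_lmeasurable) auto
  ultimately show ?thesis by (simp add: processed_def)
qed

lemma processed_mono:
  assumes "valid_schedule I S" "0 \<le> u" "u \<le> t"
  shows "processed S j u \<le> processed S j t"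
  using processed_diff[OF assms, of j] measure_nonneg[of lebesgue] by (smt (verit))

lemma processed_nonneg: "0 \<le> processed S j t"
  by (simp add: processed_def)

text \<open>A schedule names at most one job per instant, so the slots of different jobs are
  disjoint subsets of the interval.\<close>

lemma sum_processed_diff_le:
  assumes S: "valid_schedule I S" and t: "0 \<le> u" "u \<le> t" and F: "finite F"
  shows "(\<Sum>j\<in>F. processed S j t - processed S j u) \<le> t - u"
proof -
  have "(\<Sum>j\<in>F. processed S j t - processed S j u)
      = (\<Sum>j\<in>F. measure lebesgue {s \<in> {u<..t}. S s = Some j})"
    by (simp add: processed_diff[OF S t])
  also have "\<dots> = measure lebesgue (\<Union>j\<in>F. {s \<in> {u<..t}. S s = Some j})"
  proof (rule measure_finite_Union[symmetric, OF F])
    show "(\<lambda>j. {s \<in> {u<..t}. S s = Some j}) ` F \<subseteq> sets lebesgue"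
      by (intro image_subsetI fmeasurableD job_slots_lmeasurable[OF S] half_open_lmeasurable)
    show "emeasure lebesgue {s \<in> {u<..t}. S s = Some j} \<noteq> \<infinity>" for j
      by (intro job_slots_emeasure_finite[OF S] half_open_lmeasurable)
  qed (auto simp: disjoint_family_on_def)
  also have "\<dots> \<le> measure lebesgue {u<..t}"
    by (intro measure_mono_fmeasurable sets.finite_UN F fmeasurableD job_slots_lmeasurable[OF S]
          half_open_lmeasurable) auto
  also have "\<dots> = t - u" using t by simp
  finally show ?thesis .
qed

lemma processed_diff_le:
  assumes "valid_schedule I S" "0 \<le> u" "u \<le> t"
  shows "processed S j t \<le> processed S j u + (t - u)"
  using sum_processed_diff_le[OF assms, of "{j}"] by simp

lemma processed_0: "processed S j 0 = 0"
proof -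
  have "{s \<in> {0..0::real}. S s = Some j} \<in> null_sets lebesgue"
    by (rule null_sets_completion_subset[of _ "{0}"]) auto
  then show ?thesis unfolding processed_def by (simp add: null_sets_def measure_def)
qed

text \<open>Validity forbids slots before the release, so within \<open>{0..t}\<close> only the null
  set \<open>{t}\<close> can be used.\<close>

lemma processed_at_release:
  assumes S: "valid_schedule I S" and "0 \<le> t" "t \<le> release I j"
  shows "processed S j t = 0"
proof -
  have "{s \<in> {0..t}. S s = Some j} \<in> null_sets lebesgue"
    by (rule null_sets_completion_subset[of _ "{t}"]) (use assms in \<open>force simp: valid_schedule_def\<close>)+
  then show ?thesis unfolding processed_def by (simp add: null_sets_def measure_def)
qed

lemma sum_processed_le:
  assumes "valid_schedule I S" "0 \<le> t" "finite F"
  shows "(\<Sum>j\<in>F. processed S j t) \<le> t"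
  using sum_processed_diff_le[OF assms(1) order.refl assms(2,3)] by (simp add: processed_0)

text \<open>Agreement strictly before \<open>T\<close> suffices even for \<open>t = T\<close>,
  because a single instant is null. This is why decisions are compared on half-open intervals
  only.\<close>

lemma processed_cong:
  assumes S: "valid_schedule I S" and S': "valid_schedule I' S'"
    and eq: "\<And>s. 0 \<le> s \<Longrightarrow> s < T \<Longrightarrow> S s = S' s" and "t \<le> T"
  shows "processed S j t = processed S' j t"
  unfolding processed_def
proof (rule measure_eq_AE)
  have "AE s in lebesgue. s \<noteq> t"
    by (rule AE_I'[of "{t}"]) auto
  then show "AE s in lebesgue. s \<in> {s \<in> {0..t}. S s = Some j} \<longleftrightarrow> s \<in> {s \<in> {0..t}. S' s = Some j}"
    by eventually_elim (use eq assms(4) in auto)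
qed (intro fmeasurableD job_slots_lmeasurable[OF S] job_slots_lmeasurable[OF S'] lmeasurable_interval)+

lemma clairvoyant_valid_schedule:
  "clairvoyant_algorithm \<epsilon> A \<Longrightarrow> valid_instance I \<Longrightarrow> valid_schedule I (A I)"
  by (simp add: clairvoyant_algorithm_def)

text \<open>At the infimum of the times at which the observations differ, both runs have done the same work.
  Revelation is a closed condition on work that grows continuously, so no job is newly revealed in a
  short interval to the right of that infimum, a contradiction.\<close>

lemma indistinguishable_schedule:
  assumes A: "clairvoyant_algorithm \<epsilon> A" and I: "valid_instance I" and I': "valid_instance I'"
    and rel: "\<And>j. (j \<in> jobs I \<and> release I j < T) \<longleftrightarrow> (j \<in> jobs I' \<and> release I' j < T)"
      "\<And>j. j \<in> jobs I \<Longrightarrow> release I j < T \<Longrightarrow> release I j = release I' j"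
    and hidden: "\<And>j. j \<in> jobs I \<Longrightarrow> release I j < T \<Longrightarrow> proc_time I j \<noteq> proc_time I' j \<Longrightarrow>
      processed (A I) j T < (1 - \<epsilon>) * proc_time I j \<and> processed (A I) j T < (1 - \<epsilon>) * proc_time I' j"
    and t: "0 \<le> t" "t < T"
  shows "A I t = A I' t"
proof (rule ccontr)
  assume neq: "A I t \<noteq> A I' t"
  note S = clairvoyant_valid_schedule[OF A I] and S' = clairvoyant_valid_schedule[OF A I']
  have rel_info: "released_info I s = released_info I' s" if "s < T" for s
  proof -
    have "(j \<in> jobs I \<and> release I j \<le> s) \<longleftrightarrow> (j \<in> jobs I' \<and> release I' j \<le> s)" for j
      using rel[of j] that by (metis order.strict_trans1)
    moreover have "release I j = release I' j" if "j \<in> jobs I" "release I j \<le> s" for j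
      using rel(2)[of j] that \<open>s < T\<close> by auto
    ultimately show ?thesis unfolding released_info_def
      by (intro set_eqI) (smt (verit) mem_Collect_eq)
  qed
  define obs_differ where "obs_differ s \<longleftrightarrow>
    revealed_info \<epsilon> I (A I) s \<noteq> revealed_info \<epsilon> I' (A I') s" for s
  define B where "B = {s. 0 \<le> s \<and> s < T \<and> obs_differ s}"
  have agree: "A I u = A I' u" if "0 \<le> u" "u < T" "\<forall>s\<in>{0..u}. s \<notin> B" for u
  proof -
    have "\<forall>s\<in>{0..u}. released_info I s = released_info I' s \<and>
        revealed_info \<epsilon> I (A I) s = revealed_info \<epsilon> I' (A I') s"
      using that rel_info by (auto simp: B_def obs_differ_def)
    then show ?thesis
      using A I I' that(1) unfolding clairvoyant_algorithm_def by blast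
  qed
  with t neq obtain s0 where s0: "s0 \<in> B" by blast
  define \<tau> where "\<tau> = Inf B"
  have bdd: "bdd_below B" by (rule bdd_belowI[of _ 0]) (auto simp: B_def)
  have \<tau>_le: "\<tau> \<le> s" if "s \<in> B" for s unfolding \<tau>_def by (rule cInf_lower[OF that bdd])
  have \<tau>0: "0 \<le> \<tau>" unfolding \<tau>_def by (rule cInf_greatest) (use s0 in \<open>auto simp: B_def\<close>)
  have \<tau>T: "\<tau> < T" using \<tau>_le[OF s0] s0 by (auto simp: B_def)
  have same: "processed (A I) j \<tau> = processed (A I') j \<tau>" for j
  proof (rule processed_cong[OF S S' _ order.refl])
    fix s assume "0 \<le> s" "s < \<tau>"
    then show "A I s = A I' s" using \<tau>T \<tau>_le by (intro agree) force+
  qed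
  \<comment> \<open>The distances at \<open>\<tau>\<close> from the revelation thresholds still
    ahead, in either instance. Work grows at rate at most one, so none of them is reached before
    \<open>\<tau> + \<eta>\<close>; the extra 1 keeps the set nonempty.\<close>
  define G where "G = insert 1 ((\<lambda>j. (1 - \<epsilon>) * proc_time I j - processed (A I) j \<tau>) ` jobs I \<union>
     (\<lambda>j. (1 - \<epsilon>) * proc_time I' j - processed (A I) j \<tau>) ` jobs I) \<inter> {0<..}"
  define \<eta> where "\<eta> = Min G"
  have finG: "finite G" using I by (simp add: G_def valid_instance_def)
  have "G \<noteq> {}" by (auto simp: G_def)
  then have \<eta>: "\<eta> > 0" "\<And>g. g \<in> G \<Longrightarrow> \<eta> \<le> g"
    using finG Min_in[OF finG] by (auto simp: \<eta>_def G_def)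
  have no_diff: "\<not> obs_differ u" if u: "\<tau> \<le> u" "u < \<tau> + \<eta>" "u < T" for u
  proof -
    have bound: "processed (A I) j u \<le> processed (A I) j \<tau> + (u - \<tau>)"
       "processed (A I') j u \<le> processed (A I) j \<tau> + (u - \<tau>)"
       "processed (A I) j \<tau> \<le> processed (A I) j u" "processed (A I) j \<tau> \<le> processed (A I') j u" for j
      using processed_diff_le[OF S \<tau>0 u(1)] processed_diff_le[OF S' \<tau>0 u(1)]
        processed_mono[OF S \<tau>0 u(1)] processed_mono[OF S' \<tau>0 u(1)] by (auto simp: same)
    \<comment> \<open>For equal sizes, the threshold is either passed at \<open>\<tau>\<close> by
      both runs or out of reach until \<open>u\<close> for both. For different sizes,
      \<open>hidden\<close> puts both thresholds out of reach.\<close>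
    have key: "(proc_time I j = x \<and> proc_time I j - processed (A I) j u \<le> \<epsilon> * proc_time I j) \<longleftrightarrow>
       (proc_time I' j = x \<and> proc_time I' j - processed (A I') j u \<le> \<epsilon> * proc_time I' j)"
      if j: "j \<in> jobs I" "release I j \<le> u" for j x
    proof -
      define g where "g = (1 - \<epsilon>) * proc_time I j - processed (A I) j \<tau>"
      define g' where "g' = (1 - \<epsilon>) * proc_time I' j - processed (A I) j \<tau>"
      have jT: "release I j < T" using j u by simp
      have gu: "g > 0 \<Longrightarrow> u - \<tau> < g" "g' > 0 \<Longrightarrow> u - \<tau> < g'"
        using \<eta>(2)[of g] \<eta>(2)[of g'] j(1) u(2) by (force simp: G_def g_def g'_def)+
      show ?thesis
      proof (cases "proc_time I j = proc_time I' j")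
        case True
        have "((1 - \<epsilon>) * proc_time I j \<le> processed (A I) j u) \<longleftrightarrow> ((1 - \<epsilon>) * proc_time I j \<le> processed (A I') j u)"
          using gu bound[of j] by (cases "g > 0") (auto simp: g_def)
        with True show ?thesis by (auto simp: algebra_simps)
      next
        case False
        have "processed (A I) j \<tau> \<le> processed (A I) j T"
          using processed_mono[OF S \<tau>0] \<tau>T by simp
        then have "g > 0" "g' > 0" using hidden[OF j(1) jT False] by (auto simp: g_def g'_def)
        then show ?thesis using gu bound[of j] by (auto simp: g_def g'_def algebra_simps)
      qed
    qed
    have "(j \<in> jobs I \<and> release I j \<le> u) \<longleftrightarrow> (j \<in> jobs I' \<and> release I' j \<le> u)" for j
      using rel[of j] u by (metis order.strict_trans1)
    with key show ?thesis unfolding obs_differ_def revealed_info_def by auto blast+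
  qed
  have "\<exists>s\<in>B. s < \<tau> + \<eta>"
    using cInf_lessD[of B "\<tau> + \<eta>"] s0 \<eta>(1) by (auto simp: \<tau>_def)
  then obtain s where "s \<in> B" "s < \<tau> + \<eta>" by blast
  then show False using no_diff[of s] \<tau>_le[of s] by (auto simp: B_def)
qed

text \<open>Jobs released at \<open>T\<close> or later are unconstrained, so a phase or a stream
  that starts at \<open>T\<close> cannot influence the work done up to \<open>T\<close>.\<close>

lemma indistinguishable_processed:
  assumes A: "clairvoyant_algorithm \<epsilon> A" and I: "valid_instance I" and I': "valid_instance I'"
    and "\<And>j. (j \<in> jobs I \<and> release I j < T) \<longleftrightarrow> (j \<in> jobs I' \<and> release I' j < T)"
      "\<And>j. j \<in> jobs I \<Longrightarrow> release I j < T \<Longrightarrow> release I j = release I' j"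
    and "\<And>j. j \<in> jobs I \<Longrightarrow> release I j < T \<Longrightarrow> proc_time I j \<noteq> proc_time I' j \<Longrightarrow>
      processed (A I) j T < (1 - \<epsilon>) * proc_time I j \<and> processed (A I) j T < (1 - \<epsilon>) * proc_time I' j"
  shows "processed (A I) j T = processed (A I') j T"
  using indistinguishable_schedule[OF assms]
  by (intro processed_cong[OF clairvoyant_valid_schedule[OF A I] clairvoyant_valid_schedule[OF A I'] _ order.refl])

section \<open>Bounds on flow times\<close>

lemma completion_time_ge:
  assumes S: "valid_schedule I S" and "0 \<le> t" "processed S j t < proc_time I j"
  shows "ennreal t \<le> completion_time I S j"
  unfolding completion_time_def
proof (rule Inf_greatest, clarify)
  fix u assume u: "0 \<le> u" "proc_time I j \<le> processed S j u"
  have "t \<le> u"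
  proof (rule ccontr)
    assume "\<not> t \<le> u"
    then have "processed S j u \<le> processed S j t" using processed_mono[OF S u(1)] by simp
    with u assms(3) show False by simp
  qed
  then show "ennreal t \<le> ennreal u" by (rule ennreal_leI)
qed

lemma completion_time_le:
  assumes "0 \<le> t" "proc_time I j \<le> processed S j t"
  shows "completion_time I S j \<le> ennreal t"
  unfolding completion_time_def by (rule Inf_lower) (use assms in auto)

text \<open>If \<open>a\<close> and \<open>b\<close> are the first and the last counted step, the
  job is in the system from the start of step \<open>a\<close> to the end of step \<open>b\<close>,
  at least as long as all counted steps together.\<close>

lemma flow_time_ge_alive_steps:
  assumes S: "valid_schedule I S" and nn: "0 \<le> release I j" "0 \<le> \<tau>" "0 \<le> \<delta>"
  shows "ennreal (\<delta> * card {i. i < N \<and> release I j \<le> \<tau> + real i * \<delta> \<and>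
            processed S j (\<tau> + real (Suc i) * \<delta>) < proc_time I j})
         \<le> completion_time I S j - ennreal (release I j)" (is "ennreal (\<delta> * card ?M) \<le> _")
proof (cases "?M = {}")
  case True
  show ?thesis unfolding True by simp
next
  case False
  have fin: "finite ?M" by simp
  define a where "a = Min ?M"
  define b where "b = Max ?M"
  have a: "a \<in> ?M" and b: "b \<in> ?M" unfolding a_def b_def using fin False by (rule Min_in, rule Max_in)
  have "?M \<subseteq> {a..b}"
    unfolding a_def b_def using Min_le[OF fin] Max_ge[OF fin] by (meson atLeastAtMost_iff subsetI)
  then have "card ?M \<le> card {a..b}" by (rule card_mono[OF finite_atLeastAtMost])
  moreover have "a \<le> b" unfolding a_def by (rule Min_le[OF fin b])
  ultimately have "real (card ?M) \<le> real b + 1 - real a" by (simp add: of_nat_diff)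
  then have "\<delta> * card ?M \<le> \<delta> * (real b + 1 - real a)" using nn by (intro mult_left_mono)
  also have "\<dots> \<le> \<tau> + real (Suc b) * \<delta> - release I j" using a by (simp add: algebra_simps)
  finally have "ennreal (\<delta> * card ?M) \<le> ennreal (\<tau> + real (Suc b) * \<delta> - release I j)"
    by (rule ennreal_leI)
  also have "\<dots> = ennreal (\<tau> + real (Suc b) * \<delta>) - ennreal (release I j)"
    using nn by (simp add: ennreal_minus del: ennreal_plus)
  also have "\<dots> \<le> completion_time I S j - ennreal (release I j)"
    using nn b by (intro ennreal_minus_mono completion_time_ge[OF S]) auto
  finally show ?thesis .
qed

text \<open>Double counting of the pairs of a step and a job alive throughout it.\<close>

lemma total_flow_time_ge_alive_steps:
  assumes I: "valid_instance I" and S: "valid_schedule I S" and nn: "0 \<le> \<tau>" "0 \<le> \<delta>"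
  shows "ennreal (\<delta> * (\<Sum>i<N. card {j \<in> jobs I. release I j \<le> \<tau> + real i * \<delta> \<and>
            processed S j (\<tau> + real (Suc i) * \<delta>) < proc_time I j})) \<le> total_flow_time I S"
proof -
  define P where "P i j \<longleftrightarrow> release I j \<le> \<tau> + real i * \<delta> \<and>
            processed S j (\<tau> + real (Suc i) * \<delta>) < proc_time I j" for i j
  have fin: "finite (jobs I)" using I by (simp add: valid_instance_def)
  have "(\<Sum>i<N. card {j \<in> jobs I. P i j}) = (\<Sum>j\<in>jobs I. card {i \<in> {..<N}. P i j})"
    by (rule sum_multicount_gen[OF _ fin]) auto
  then have "real (\<Sum>i<N. card {j \<in> jobs I. P i j}) = (\<Sum>j\<in>jobs I. real (card {i. i < N \<and> P i j}))"
    by simp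
  then have "ennreal (\<delta> * (\<Sum>i<N. card {j \<in> jobs I. P i j})) =
      ennreal (\<Sum>j\<in>jobs I. \<delta> * card {i. i < N \<and> P i j})"
    by (simp add: sum_distrib_left)
  also have "\<dots> = (\<Sum>j\<in>jobs I. ennreal (\<delta> * card {i. i < N \<and> P i j}))"
    using nn by (simp add: sum_ennreal)
  also have "\<dots> \<le> total_flow_time I S"
    unfolding total_flow_time_def P_def
    by (intro sum_mono flow_time_ge_alive_steps[OF S] nn) (use I in \<open>auto simp: valid_instance_def\<close>)
  finally show ?thesis by (simp add: P_def)
qed

lemma opt_le_total_flow_time:
  "valid_schedule I S \<Longrightarrow> opt_flow_time I \<le> total_flow_time I S"
  unfolding opt_flow_time_def by (intro Inf_lower) auto

text \<open>The half-open intervals \<open>{a j..<a j + proc_time I j}\<close> are disjoint, so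
  start times alone determine a schedule.\<close>

lemma opt_flow_time_le_nonpreemptive:
  assumes I: "valid_instance I" and rel: "\<And>j. j \<in> jobs I \<Longrightarrow> release I j \<le> a j"
    and disj: "\<And>i j. i \<in> jobs I \<Longrightarrow> j \<in> jobs I \<Longrightarrow> i \<noteq> j \<Longrightarrow>
      a i + proc_time I i \<le> a j \<or> a j + proc_time I j \<le> a i"
  shows "opt_flow_time I \<le> ennreal (\<Sum>j\<in>jobs I. a j + proc_time I j - release I j)"
proof -
  define run where "run j t \<longleftrightarrow> j \<in> jobs I \<and> a j \<le> t \<and> t < a j + proc_time I j" for j t
  define S where "S t = (if \<exists>j. run j t then Some (SOME j. run j t) else None)" for t
  have uniq: "i = j" if "run i t" "run j t" for i j t
    using that disj[of i j] by (force simp: run_def)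
  have S_iff: "S t = Some j \<longleftrightarrow> run j t" for t j
    using uniq by (auto simp: S_def intro: someI some_equality)
  have slots: "{t. S t = Some j} = (if j \<in> jobs I then {a j..<a j + proc_time I j} else {})" for j
    by (auto simp: S_iff run_def)
  have valid: "valid_schedule I S"
    unfolding valid_schedule_def
  proof (intro conjI allI impI)
    show "{t. S t = Some j} \<in> sets lebesgue" for j by (simp add: slots)
  qed (use rel in \<open>force simp: S_iff run_def\<close>)+
  have job: "completion_time I S j - ennreal (release I j)
      \<le> ennreal (a j + proc_time I j - release I j)" if j: "j \<in> jobs I" for j
  proof -
    have nn: "0 \<le> release I j" "0 < proc_time I j" "0 \<le> a j"
      using I j rel[OF j] by (auto simp: valid_instance_def)
    have "{s \<in> {0..a j + proc_time I j}. S s = Some j} = {a j..<a j + proc_time I j}"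
      using nn j by (auto simp: S_iff run_def)
    then have "processed S j (a j + proc_time I j) = proc_time I j"
      using nn by (simp add: processed_def)
    then have "completion_time I S j \<le> ennreal (a j + proc_time I j)"
      using nn by (intro completion_time_le) auto
    then have "completion_time I S j - ennreal (release I j)
       \<le> ennreal (a j + proc_time I j) - ennreal (release I j)"
      by (intro ennreal_minus_mono) auto
    then show ?thesis using nn by (simp add: ennreal_minus del: ennreal_plus)
  qed
  have "opt_flow_time I \<le> total_flow_time I S"
    by (rule opt_le_total_flow_time[OF valid])
  also have "\<dots> \<le> (\<Sum>j\<in>jobs I. ennreal (a j + proc_time I j - release I j))"
    unfolding total_flow_time_def by (intro sum_mono job)
  also have "\<dots> = ennreal (\<Sum>j\<in>jobs I. a j + proc_time I j - release I j)"
    using I rel by (intro sum_ennreal) (force simp: valid_instance_def)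
  finally show ?thesis .
qed

section \<open>Start times of jobs run back to back in index order\<close>

definition seq_start :: "real \<Rightarrow> (nat \<Rightarrow> real) \<Rightarrow> nat set \<Rightarrow> nat \<Rightarrow> real" where
  "seq_start u p F j = u + (\<Sum>i\<in>{i \<in> F. i < j}. p i)"

lemma seq_start_ge:
  assumes "\<And>i. i \<in> F \<Longrightarrow> 0 \<le> p i"
  shows "u \<le> seq_start u p F j"
  unfolding seq_start_def using assms by (auto intro: sum_nonneg)

lemma seq_start_end_le:
  assumes "finite F" "\<And>i. i \<in> F \<Longrightarrow> 0 \<le> p i" "j \<in> F"
  shows "seq_start u p F j + p j \<le> u + sum p F"
proof -
  have "(\<Sum>i\<in>{i \<in> F. i < j}. p i) + p j = sum p (insert j {i \<in> F. i < j})"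
    using assms by simp
  also have "\<dots> \<le> sum p F" by (rule sum_mono2) (use assms in auto)
  finally show ?thesis by (simp add: seq_start_def)
qed

lemma seq_start_end_le_start:
  assumes "finite F" "\<And>i. i \<in> F \<Longrightarrow> 0 \<le> p i" "i \<in> F" "i < j"
  shows "seq_start u p F i + p i \<le> seq_start u p F j"
proof -
  have "(\<Sum>h\<in>{h \<in> F. h < i}. p h) + p i = sum p (insert i {h \<in> F. h < i})"
    using assms by simp
  also have "\<dots> \<le> sum p {h \<in> F. h < j}" by (rule sum_mono2) (use assms in auto)
  finally show ?thesis by (simp add: seq_start_def)
qed

lemma seq_start_disjoint:
  assumes "finite F" "\<And>i. i \<in> F \<Longrightarrow> 0 \<le> p i" "i \<in> F" "j \<in> F" "i \<noteq> j"
  shows "seq_start u p F i + p i \<le> seq_start u p F j \<or> seq_start u p F j + p j \<le> seq_start u p F i"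
proof (cases "i < j")
  case True
  show ?thesis using seq_start_end_le_start[where p = p, OF assms(1-3) True] by simp
next
  case False
  with assms(5) have "j < i" by simp
  show ?thesis using seq_start_end_le_start[where p = p, OF assms(1,2,4) \<open>j < i\<close>] by simp
qed

section \<open>Appending a stream of small jobs\<close>

text \<open>Old jobs keep their indices \<open>j < n\<close>, so work can be compared job by job.
  The gap between releases equals the size of a stream job, so serving the stream on arrival
  occupies the machine throughout.\<close>

definition add_stream :: "nat \<Rightarrow> real \<Rightarrow> real \<Rightarrow> nat \<Rightarrow> sched_instance \<Rightarrow> sched_instance" where
  "add_stream n \<tau> \<delta> N I = \<lparr>jobs = {..<n + N},
     release = (\<lambda>j. if j < n then release I j else \<tau> + real (j - n) * \<delta>),
     proc_time = (\<lambda>j. if j < n then proc_time I j else \<delta>)\<rparr>"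

lemma add_stream_valid:
  assumes "valid_instance I" "jobs I = {..<n}" "0 \<le> \<tau>" "0 < \<delta>"
  shows "valid_instance (add_stream n \<tau> \<delta> N I)"
  using assms by (auto simp: valid_instance_def add_stream_def)

text \<open>The part of the optimum's plan before the stream: \<open>E\<close> is what it finishes
  by \<open>\<tau>\<close>, without preemption.\<close>

definition early_schedule :: "sched_instance \<Rightarrow> real \<Rightarrow> nat set \<Rightarrow> (nat \<Rightarrow> real) \<Rightarrow> bool" where
  "early_schedule I \<tau> E a \<longleftrightarrow> E \<subseteq> jobs I \<and>
     (\<forall>j\<in>E. release I j \<le> a j \<and> a j + proc_time I j \<le> \<tau>) \<and>
     (\<forall>i\<in>E. \<forall>j\<in>E. i \<noteq> j \<longrightarrow> a i + proc_time I i \<le> a j \<or> a j + proc_time I j \<le> a i)"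

text \<open>The plan runs \<open>E\<close> before \<open>\<tau>\<close>, every stream job on
  arrival, and the remaining jobs back to back after the stream. Only the latter wait for the length
  \<open>N * \<delta>\<close> of the stream; the extra 1 is the flow time of the stream
  itself.\<close>

lemma opt_add_stream_le:
  assumes I: "valid_instance I" and J: "jobs I = {..<n}" and \<tau>: "0 \<le> \<tau>" and \<delta>: "0 < \<delta>"
    and rel: "\<And>j. j < n \<Longrightarrow> release I j \<le> \<tau>" and early: "early_schedule I \<tau> E a"
  shows "opt_flow_time (add_stream n \<tau> \<delta> N I)
    \<le> ennreal (real n * (\<tau> + (\<Sum>j<n. proc_time I j)) + (real (card ({..<n} - E)) + 1) * (real N * \<delta>))"
proof -
  let ?I = "add_stream n \<tau> \<delta> N I" and ?p = "proc_time I"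
  define L where "L = {..<n} - E"
  define W where "W = (\<Sum>j<n. ?p j)"
  have E: "E \<subseteq> {..<n}" using early J by (simp add: early_schedule_def)
  have p: "0 < ?p j" "0 \<le> release I j" if "j < n" for j using I J that by (auto simp: valid_instance_def)
  have finL: "finite L" by (simp add: L_def)
  have pL: "0 \<le> ?p j" if "j \<in> L" for j using p[of j] that by (auto simp: L_def)
  define b where "b j = (if n \<le> j then \<tau> + real (j - n) * \<delta> else if j \<in> E then a j
      else seq_start (\<tau> + real N * \<delta>) ?p L j)" for j
  have b_early: "release I j \<le> b j" "b j + ?p j \<le> \<tau>" if "j \<in> E" for j
    using that early E by (auto simp: b_def early_schedule_def)
  have b_stream: "b j = \<tau> + real (j - n) * \<delta>" "\<tau> \<le> b j" if "n \<le> j" for j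
    using that \<delta> by (auto simp: b_def)
  have b_stream_end: "b j + \<delta> \<le> \<tau> + real N * \<delta>" if "n \<le> j" "j < n + N" for j
  proof -
    have "(real (j - n) + 1) * \<delta> \<le> real N * \<delta>"
      using that \<delta> by (intro mult_right_mono) auto
    then show ?thesis using that by (simp add: b_stream algebra_simps)
  qed
  have b_late: "\<tau> + real N * \<delta> \<le> b j" if "j \<in> L" for j
    using that seq_start_ge[where F = L and p = ?p, OF pL] by (auto simp: b_def L_def)
  have W: "sum ?p L \<le> W" unfolding W_def by (rule sum_mono2) (auto simp: L_def less_imp_le p)
  have b_late_end: "b j + ?p j \<le> \<tau> + real N * \<delta> + W" if "j \<in> L" for j
  proof -
    have "b j = seq_start (\<tau> + real N * \<delta>) ?p L j" using that by (auto simp: b_def L_def)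
    then show ?thesis using seq_start_end_le[where p = ?p and u = "\<tau> + real N * \<delta>", OF finL pL that] W by simp
  qed
  have N0: "0 \<le> real N * \<delta>" using \<delta> by simp
  have cases_j: "j \<in> E \<or> j \<in> L \<or> (n \<le> j \<and> j < n + N)" if "j < n + N" for j
    using that by (auto simp: L_def)
  have W0: "0 \<le> W" unfolding W_def by (intro sum_nonneg) (simp add: less_imp_le p)
  have opt: "opt_flow_time ?I \<le> ennreal (\<Sum>j\<in>jobs ?I. b j + proc_time ?I j - release ?I j)"
  proof (rule opt_flow_time_le_nonpreemptive)
    show "valid_instance ?I" by (rule add_stream_valid) fact+
  next
    fix j assume "j \<in> jobs ?I"
    then have "j < n + N" by (simp add: add_stream_def)
    from cases_j[OF this] show "release ?I j \<le> b j"
      using b_early[of j] b_stream[of j] b_late[of j] E rel[of j] N0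
      by (auto simp: add_stream_def L_def)
  next
    have main: "b i + proc_time ?I i \<le> b j \<or> b j + proc_time ?I j \<le> b i"
      if ij: "i < n + N" "j < n + N" "i < j" for i j
    proof -
      \<comment> \<open>Stream jobs have the largest indices, so \<open>i < j\<close> excludes a
        stream job \<open>i\<close> with an old job \<open>j\<close>.\<close>
      consider "i \<in> E" "j \<in> E" | "i \<in> E" "j \<in> L" | "i \<in> E" "n \<le> j" | "i \<in> L" "j \<in> E"
        | "i \<in> L" "j \<in> L" | "i \<in> L" "n \<le> j" | "n \<le> i" "n \<le> j"
        using cases_j[OF ij(1)] cases_j[OF ij(2)] ij E by (auto simp: L_def)
      then show ?thesis
      proof cases
        case 1
        then show ?thesis using early E ij by (force simp: early_schedule_def b_def add_stream_def)
      next
        case 2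
        then show ?thesis using b_early[of i] b_late[of j] N0 E by (auto simp: add_stream_def)
      next
        case 3
        then show ?thesis using b_early[of i] b_stream[of j] E by (auto simp: add_stream_def)
      next
        case 4
        then show ?thesis using b_early[of j] b_late[of i] N0 E by (auto simp: add_stream_def)
      next
        case 5
        then have "b i = seq_start (\<tau> + real N * \<delta>) ?p L i" "b j = seq_start (\<tau> + real N * \<delta>) ?p L j"
          "i < n" "j < n"
          by (auto simp: b_def L_def)
        then show ?thesis using seq_start_end_le_start[where p = ?p and u = "\<tau> + real N * \<delta>", OF finL pL 5(1) ij(3)]
          by (auto simp: add_stream_def)
      next
        case 6
        then show ?thesis using b_late[of i] b_stream_end[of j] ij by (auto simp: add_stream_def)
      next
        case 7
        then have "real (i - n) + 1 \<le> real (j - n)" using ij by (simp add: of_nat_diff)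
        then have "(real (i - n) + 1) * \<delta> \<le> real (j - n) * \<delta>" using \<delta> by (intro mult_right_mono) auto
        then show ?thesis using 7 by (auto simp: b_stream add_stream_def algebra_simps)
      qed
    qed
    fix i j assume "i \<in> jobs ?I" "j \<in> jobs ?I" "i \<noteq> j"
    then show "b i + proc_time ?I i \<le> b j \<or> b j + proc_time ?I j \<le> b i"
      using main[of i j] main[of j i] by (cases "i < j") (auto simp: add_stream_def)
  qed
  have "(\<Sum>j\<in>jobs ?I. b j + proc_time ?I j - release ?I j)
     = (\<Sum>j<n. b j + ?p j - release I j) + (\<Sum>j\<in>{n..<n + N}. \<delta>)"
  proof -
    have "jobs ?I = {..<n} \<union> {n..<n + N}" by (auto simp: add_stream_def)
    then show ?thesis
      by (simp add: sum.union_disjoint ivl_disj_int add_stream_def b_stream)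
  qed
  also have "(\<Sum>j<n. b j + ?p j - release I j) \<le> (\<Sum>j<n. \<tau> + W + (if j \<in> L then real N * \<delta> else 0))"
  proof (rule sum_mono)
    fix j assume "j \<in> {..<n}"
    then show "b j + ?p j - release I j \<le> \<tau> + W + (if j \<in> L then real N * \<delta> else 0)"
      using b_early[of j] b_late_end[of j] p(2)[of j] W0 by (cases "j \<in> E") (auto simp: L_def)
  qed
  also have "\<dots> = real n * (\<tau> + W) + real (card L) * (real N * \<delta>)"
  proof -
    have "{..<n} \<inter> L = L" by (auto simp: L_def)
    then show ?thesis by (simp add: sum.distrib sum.If_cases)
  qed
  finally have "(\<Sum>j\<in>jobs ?I. b j + proc_time ?I j - release ?I j)
     \<le> real n * (\<tau> + W) + (real (card L) + 1) * (real N * \<delta>)" by (simp add: algebra_simps)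
  then show ?thesis using opt unfolding W_def L_def by (meson ennreal_leI order.trans)
qed

text \<open>At the end of step \<open>i\<close>, the total size of the stream jobs that have arrived
  equals the time elapsed since \<open>\<tau>\<close>. Work spent on old jobs is missing for them,
  and each unfinished stream job covers at most \<open>\<delta>\<close> of this deficit.\<close>

lemma stream_alive_ge:
  assumes S: "valid_schedule (add_stream n \<tau> \<delta> N I) S" and \<tau>: "0 \<le> \<tau>" and \<delta>: "0 < \<delta>" and i: "i < N"
  shows "(\<Sum>j<n. processed S j (\<tau> + real (Suc i) * \<delta>) - processed S j \<tau>)
    \<le> \<delta> * card {j \<in> {n..<n + Suc i}. processed S j (\<tau> + real (Suc i) * \<delta>) < \<delta>}"
proof -
  let ?t = "\<tau> + real (Suc i) * \<delta>" and ?I = "add_stream n \<tau> \<delta> N I"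
  define F where "F = {j \<in> {n..<n + Suc i}. \<not> processed S j ?t < \<delta>}"
  define R where "R = {j \<in> {n..<n + Suc i}. processed S j ?t < \<delta>}"
  have "R \<union> F = {n..<n + Suc i}" by (auto simp: R_def F_def)
  moreover have "card (R \<union> F) = card R + card F"
    by (rule card_Un_disjoint) (auto simp: R_def F_def)
  ultimately have "card R + card F = card {n..<n + Suc i}" by simp
  then have cards: "real (card R) + real (card F) = real (Suc i)" by simp
  have zero: "processed S j \<tau> = 0" if "n \<le> j" for j
    using that \<delta> by (intro processed_at_release[OF S \<tau>]) (simp add: add_stream_def)
  have "\<delta> * card F = (\<Sum>j\<in>F. \<delta>)" by simp
  also have "\<dots> \<le> (\<Sum>j\<in>F. processed S j ?t - processed S j \<tau>)"
    by (rule sum_mono) (auto simp: F_def zero)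
  finally have "(\<Sum>j<n. processed S j ?t - processed S j \<tau>) + \<delta> * card F
     \<le> (\<Sum>j<n. processed S j ?t - processed S j \<tau>) + (\<Sum>j\<in>F. processed S j ?t - processed S j \<tau>)"
    by simp
  also have "\<dots> = (\<Sum>j\<in>{..<n} \<union> F. processed S j ?t - processed S j \<tau>)"
    by (rule sum.union_disjoint[symmetric]) (auto simp: F_def)
  also have "\<dots> \<le> ?t - \<tau>"
    using \<delta> by (intro sum_processed_diff_le[OF S \<tau>]) (auto simp: F_def)
  also have "\<dots> = \<delta> * (real (card R) + real (card F))" unfolding cards by simp
  finally show ?thesis unfolding R_def by (simp add: algebra_simps)
qed

text \<open>Each step is charged for the unfinished old jobs and for the waiting stream jobs; by
  \<open>stream_alive_ge\<close> the latter make up for the work put into old jobs since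
  \<open>\<tau>\<close>.\<close>

lemma total_flow_add_stream_ge:
  assumes I: "valid_instance I" and J: "jobs I = {..<n}" and \<tau>: "0 \<le> \<tau>" and \<delta>: "0 < \<delta>"
    and rel: "\<And>j. j < n \<Longrightarrow> release I j \<le> \<tau>" and S: "valid_schedule (add_stream n \<tau> \<delta> N I) S"
  shows "ennreal (\<Sum>i<N. \<delta> * card {j. j < n \<and> processed S j (\<tau> + real (Suc i) * \<delta>) < proc_time I j} +
       (\<Sum>j<n. processed S j (\<tau> + real (Suc i) * \<delta>) - processed S j \<tau>))
     \<le> total_flow_time (add_stream n \<tau> \<delta> N I) S"
proof -
  let ?I = "add_stream n \<tau> \<delta> N I"
  have step: "\<delta> * card {j. j < n \<and> processed S j (\<tau> + real (Suc i) * \<delta>) < proc_time I j} +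
       (\<Sum>j<n. processed S j (\<tau> + real (Suc i) * \<delta>) - processed S j \<tau>)
     \<le> \<delta> * card {j \<in> jobs ?I. release ?I j \<le> \<tau> + real i * \<delta> \<and>
            processed S j (\<tau> + real (Suc i) * \<delta>) < proc_time ?I j}" (is "?l \<le> \<delta> * card ?A") if i: "i < N" for i
  proof -
    let ?B = "{j. j < n \<and> processed S j (\<tau> + real (Suc i) * \<delta>) < proc_time I j}"
    let ?C = "{j \<in> {n..<n + Suc i}. processed S j (\<tau> + real (Suc i) * \<delta>) < \<delta>}"
    \<comment> \<open>Stream job \<open>n + i\<close> is released exactly at the start of step
      \<open>i\<close>, so \<open>Suc i\<close> stream jobs are counted in this step.\<close>
    have "(real j - real n) * \<delta> \<le> real i * \<delta>" if "j < n + Suc i" for j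
      using \<delta> that by (intro mult_right_mono) auto
    moreover have "release I j \<le> \<tau> + real i * \<delta>" if "j < n" for j
      using rel[OF that] \<delta> by (simp add: add_increasing2)
    ultimately have "?B \<union> ?C \<subseteq> ?A" using i by (auto simp: add_stream_def)
    then have "card (?B \<union> ?C) \<le> card ?A" by (intro card_mono) (auto simp: add_stream_def)
    moreover have "card (?B \<union> ?C) = card ?B + card ?C" by (rule card_Un_disjoint) auto
    ultimately have "\<delta> * (real (card ?B) + real (card ?C)) \<le> \<delta> * card ?A"
      using \<delta> by (intro mult_left_mono) auto
    then show ?thesis using stream_alive_ge[OF S \<tau> \<delta> i] by (simp add: algebra_simps)
  qed
  have "ennreal (\<Sum>i<N. \<delta> * card {j. j < n \<and> processed S j (\<tau> + real (Suc i) * \<delta>) < proc_time I j} +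
       (\<Sum>j<n. processed S j (\<tau> + real (Suc i) * \<delta>) - processed S j \<tau>))
     \<le> ennreal (\<Sum>i<N. \<delta> * card {j \<in> jobs ?I. release ?I j \<le> \<tau> + real i * \<delta> \<and>
            processed S j (\<tau> + real (Suc i) * \<delta>) < proc_time ?I j})"
    by (intro ennreal_leI sum_mono step) simp
  also have "\<dots> \<le> total_flow_time ?I S"
    using total_flow_time_ge_alive_steps[OF add_stream_valid[OF I J \<tau> \<delta>] S \<tau>, of \<delta> N] \<delta>
    by (simp add: sum_distrib_left)
  finally show ?thesis .
qed

text \<open>Divide by \<open>N\<close> and let \<open>N\<close> grow: the constant \<open>c\<close>
  disappears. Applied first to the length of the stream and then to the number of phases or of batch
  jobs.\<close>

lemma le_of_affine_bounds:
  fixes a b c \<rho> :: real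
  assumes "\<And>N::nat. real N * a \<le> \<rho> * (c + real N * b)"
  shows "a \<le> \<rho> * b"
proof (rule ccontr)
  assume "\<not> a \<le> \<rho> * b"
  then have "0 < a - \<rho> * b" by simp
  then obtain N :: nat where "\<rho> * c < real N * (a - \<rho> * b)"
    using reals_Archimedean3 by blast
  with assms[of N] show False by (simp add: algebra_simps)
qed

section \<open>Deterministic algorithms\<close>

text \<open>\<open>X\<close> is the largest work on a new job, \<open>Y\<close> the work on the
  other ones, and \<open>c\<close> the size added to each of the latter; it has to exceed
  \<open>c0\<close>. If \<open>X > 0\<close>, then \<open>(k - 1) * \<epsilon> < 1\<close> gives
  \<open>(k - 2) * c0 < X \<le> T - Y\<close>; if \<open>X = 0\<close>, the room comes from
  \<open>Y = 0\<close>.\<close>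

lemma phase_parameter_exists:
  fixes \<epsilon> k T X Y :: real
  assumes \<epsilon>: "0 < \<epsilon>" "\<epsilon> < 1" and k: "2 \<le> k" "(k - 1) * \<epsilon> < 1"
    and T: "0 < T" and X: "0 \<le> X" "Y + X \<le> T" "X = 0 \<Longrightarrow> Y = 0"
    and Y: "0 \<le> Y"
  obtains c where "0 < c" "X * \<epsilon> < (1 - \<epsilon>) * c" "Y + (k - 2) * c < T" "c \<le> T / (1 - \<epsilon>)"
proof -
  define c0 where "c0 = X * \<epsilon> / (1 - \<epsilon>)"
  define g where "g = T - Y - (k - 2) * c0"
  \<comment> \<open>The first bound keeps \<open>c\<close> at most
    \<open>T / (1 - \<epsilon>)\<close>; the second keeps \<open>(k - 2) * d\<close> below the slack
    \<open>g\<close>.\<close>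
  define d where "d = min (T / (1 - \<epsilon>) - c0) (g / k)"
  have c0: "0 \<le> c0" "(1 - \<epsilon>) * c0 = X * \<epsilon>" using \<epsilon> X by (auto simp: c0_def)
  have g: "0 < g"
  proof (cases "X = 0")
    case True
    then show ?thesis using X T by (simp add: g_def c0_def)
  next
    case False
    then have "X * ((k - 2) * \<epsilon>) < X * (1 - \<epsilon>)"
      using X k by (intro mult_strict_left_mono) (auto simp: algebra_simps)
    then have "(k - 2) * c0 < X" using \<epsilon> by (simp add: c0_def field_simps)
    then show ?thesis using X by (simp add: g_def)
  qed
  have "X * \<epsilon> < T"
    using X Y T \<epsilon> by (smt (verit) mult_left_le mult_less_cancel_left2)
  then have "c0 < T / (1 - \<epsilon>)" using \<epsilon> by (simp add: c0_def divide_strict_right_mono)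
  then have d: "0 < d" using g k by (simp add: d_def)
  have "(k - 2) * d \<le> (k - 2) * (g / k)" using k by (intro mult_left_mono) (auto simp: d_def)
  also have "\<dots> < g" using g k by (simp add: field_simps)
  finally have 3: "Y + (k - 2) * (c0 + d) < T" by (simp add: g_def algebra_simps)
  have "(1 - \<epsilon>) * c0 < (1 - \<epsilon>) * (c0 + d)" using d \<epsilon> by (intro mult_strict_left_mono) auto
  then have 2: "X * \<epsilon> < (1 - \<epsilon>) * (c0 + d)" using c0 by simp
  have "c0 + d \<le> T / (1 - \<epsilon>)" by (simp add: d_def min_def)
  then show ?thesis using that[of "c0 + d"] 2 3 c0 d by simp
qed

text \<open>State after \<open>m\<close> phases at time \<open>\<tau>\<close>: the algorithm has finished none of the \<open>k * m\<close> jobs, while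
  starting the jobs \<open>j \<in> E\<close> at \<open>a j\<close> finishes all but \<open>m\<close> of them.\<close>

definition phase_state :: "algorithm \<Rightarrow> nat \<Rightarrow> nat \<Rightarrow> sched_instance \<Rightarrow> real \<Rightarrow> nat set \<Rightarrow> (nat \<Rightarrow> real) \<Rightarrow> bool" where
  "phase_state A k m I \<tau> E a \<longleftrightarrow> valid_instance I \<and> jobs I = {..<k * m} \<and> 0 \<le> \<tau> \<and>
     (\<forall>j<k * m. release I j \<le> \<tau> \<and> processed (A I) j \<tau> < proc_time I j) \<and>
     early_schedule I \<tau> E a \<and> card E = (k - 1) * m"

text \<open>The algorithm is first run on \<open>I1\<close>, whose \<open>k\<close> new jobs all
  have the large size \<open>H\<close>. The sizes in \<open>I2\<close> are then chosen from the work
  \<open>x\<close> observed there so that both runs do the same work up to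
  \<open>\<tau> + T\<close>.\<close>

lemma phase_step:
  assumes A: "clairvoyant_algorithm \<epsilon> A" and \<epsilon>: "0 < \<epsilon>" "\<epsilon> < 1"
    and k: "2 \<le> k" "(real k - 1) * \<epsilon> < 1" and st: "phase_state A k m I \<tau> E a"
  shows "\<exists>I' \<tau>' E' a'. phase_state A k (Suc m) I' \<tau>' E' a'"
proof -
  define n where "n = k * m"
  have I: "valid_instance I" and J: "jobs I = {..<n}" and \<tau>: "0 \<le> \<tau>"
    and rel: "\<And>j. j < n \<Longrightarrow> release I j \<le> \<tau>"
    and alive: "\<And>j. j < n \<Longrightarrow> processed (A I) j \<tau> < proc_time I j"
    and early: "early_schedule I \<tau> E a" and cardE: "card E = (k - 1) * m"
    using st by (auto simp: phase_state_def n_def)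
  have rel0: "\<And>j. j < n \<Longrightarrow> 0 \<le> release I j" and pos: "\<And>j. j < n \<Longrightarrow> 0 < proc_time I j"
    using I J by (auto simp: valid_instance_def)

  define G where "G = insert 1 ((\<lambda>j. proc_time I j - processed (A I) j \<tau>) ` {..<n})"
  define \<mu> where "\<mu> = Min G"
  have "\<mu> \<in> G" unfolding \<mu>_def by (rule Min_in) (auto simp: G_def)
  then have \<mu>: "0 < \<mu>" using alive by (auto simp: G_def)
  have \<mu>_le: "\<mu> \<le> proc_time I j - processed (A I) j \<tau>" if "j < n" for j
    unfolding \<mu>_def by (rule Min_le) (use that in \<open>auto simp: G_def\<close>)
  \<comment> \<open>The phase will last less than
    \<open>T + c \<le> T + T / (1 - \<epsilon>) \<le> H = \<mu>\<close>, too short to finish an old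
    job or one of size \<open>H\<close>. Moreover \<open>(1 - \<epsilon>) * H = 2 * T\<close>, so
    size \<open>H\<close> stays hidden up to \<open>\<tau> + T\<close>.\<close>
  define T where "T = \<mu> * (1 - \<epsilon>) / 2"
  have T: "0 < T" using \<mu> \<epsilon> by (simp add: T_def)
  define H where "H = 2 * T / (1 - \<epsilon>)"
  have H\<mu>: "H = \<mu>" using \<epsilon> by (simp add: H_def T_def)
  have HT: "(1 - \<epsilon>) * H = 2 * T" using \<epsilon> by (simp add: H_def)
  have T_le: "T \<le> T / (1 - \<epsilon>)" using \<epsilon> T by (simp add: field_simps)
  have TH: "T + T / (1 - \<epsilon>) \<le> H" using T_le by (simp add: H_def)

  define inst where "inst q = \<lparr>jobs = {..<n + k}, release = (\<lambda>j. if j < n then release I j else \<tau>),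
     proc_time = (\<lambda>j. if j < n then proc_time I j else q j)\<rparr>" for q :: "nat \<Rightarrow> real"
  have inst_valid: "valid_instance (inst q)" if "\<And>j. j \<in> {n..<n + k} \<Longrightarrow> 0 < q j" for q
    using that rel0 pos \<tau> by (auto simp: valid_instance_def inst_def)
  define I1 where "I1 = inst (\<lambda>_. H)"
  have I1: "valid_instance I1" unfolding I1_def using H\<mu> \<mu> by (intro inst_valid) auto
  note S1 = clairvoyant_valid_schedule[OF A I1]
  define x where "x j = processed (A I1) j (\<tau> + T)" for j
  define New where "New = {n..<n + k}"
  have New: "finite New" "card New = k" "New \<noteq> {}" using k by (auto simp: New_def)
  have sum_x: "(\<Sum>j\<in>New. x j) \<le> T"
  proof -
    have "processed (A I1) j \<tau> = 0" if "j \<in> New" for j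
      using that by (intro processed_at_release[OF S1 \<tau>]) (auto simp: New_def I1_def inst_def)
    then show ?thesis
      using sum_processed_diff_le[OF S1 \<tau>, of "\<tau> + T" New] T New by (simp add: x_def)
  qed
  have x0: "0 \<le> x j" for j by (simp add: x_def processed_nonneg)
  obtain l where l: "l \<in> New" and l_max: "\<And>j. j \<in> New \<Longrightarrow> x j \<le> x l"
  proof -
    have "Max (x ` New) \<in> x ` New" using New by (intro Max_in) auto
    then obtain l where "l \<in> New" "x l = Max (x ` New)" by auto
    then show ?thesis using that[of l] New by simp
  qed
  define Small where "Small = New - {l}"
  have Small: "finite Small" "card Small = k - 1" using New l by (auto simp: Small_def)
  define Y where "Y = sum x Small"
  have Yx: "Y + x l \<le> T" using sum_x New l by (simp add: Y_def Small_def sum_diff1)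
  have Y0: "0 \<le> Y" unfolding Y_def by (intro sum_nonneg x0)
  have "Y = 0" if "x l = 0"
    unfolding Y_def using l_max that x0 by (intro sum.neutral ballI) (auto simp: Small_def intro: antisym)
  then obtain c where c: "0 < c" "x l * \<epsilon> < (1 - \<epsilon>) * c" "Y + (real k - 2) * c < T" "c \<le> T / (1 - \<epsilon>)"
    using phase_parameter_exists[OF \<epsilon> _ k(2) T x0 Yx _ Y0] k(1) by auto
  define q where "q j = (if j = l then H else x j + c)" for j
  define I2 where "I2 = inst q"
  have q0: "0 < q j" for j using c x0[of j] H\<mu> \<mu> by (auto simp: q_def)
  have I2: "valid_instance I2" unfolding I2_def by (intro inst_valid q0)
  note S2 = clairvoyant_valid_schedule[OF A I2]
  have same_old: "processed (A I2) j \<tau> = processed (A I) j \<tau>" for j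
  proof (rule indistinguishable_processed[OF A I I2, symmetric])
  qed (auto simp: J I2_def inst_def)
  have same_new: "processed (A I2) j (\<tau> + T) = x j" for j
    unfolding x_def
  proof (rule indistinguishable_processed[OF A I1 I2, symmetric])
    fix j assume "j \<in> jobs I1" "release I1 j < \<tau> + T" "proc_time I1 j \<noteq> proc_time I2 j"
    then have j: "j \<in> Small" and p: "proc_time I1 j = H" "proc_time I2 j = x j + c"
      by (auto simp: I1_def I2_def inst_def New_def Small_def q_def split: if_splits)
    then have xl: "x j \<le> x l" using l_max by (simp add: Small_def)
    \<comment> \<open>Both sizes of \<open>j\<close> stay hidden: \<open>H\<close> because
      \<open>x j \<le> T\<close>, and \<open>x j + c\<close> because \<open>c\<close> was chosen for
      the maximal work \<open>x l\<close>.\<close>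
    have "x l \<le> T" using Yx Y0 by simp
    then have "x j < (1 - \<epsilon>) * H" using xl T unfolding HT by linarith
    moreover have "x j * \<epsilon> \<le> x l * \<epsilon>" using xl \<epsilon> by (intro mult_right_mono) auto
    then have "x j < (1 - \<epsilon>) * (x j + c)" using c(2) by (simp add: algebra_simps)
    ultimately show "processed (A I1) j (\<tau> + T) < (1 - \<epsilon>) * proc_time I1 j \<and>
        processed (A I1) j (\<tau> + T) < (1 - \<epsilon>) * proc_time I2 j"
      unfolding p by (simp add: x_def)
  qed (auto simp: I1_def I2_def inst_def)

  define P where "P = Y + (real k - 1) * c"
  have P: "P < T + c" using c(3) by (simp add: P_def algebra_simps)
  \<comment> \<open>By \<open>\<tau>'\<close> both the observation period \<open>T\<close> and a run
    of the small jobs, of total size \<open>P\<close>, are over. As \<open>P < T + c\<close>, this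
    is still too early for the algorithm to finish a small job.\<close>
  define \<tau>' where "\<tau>' = \<tau> + max T P"
  have \<tau>': "\<tau> + T \<le> \<tau>'" "\<tau> + P \<le> \<tau>'" "\<tau>' < \<tau> + T + c" using P c by (auto simp: \<tau>'_def)
  have \<tau>H: "\<tau>' < \<tau> + H" using \<tau>' c(4) TH by linarith
  have "\<tau> \<le> \<tau>'" using \<tau>' T by simp
  have sum_q: "sum q Small = P"
  proof -
    have "sum q Small = (\<Sum>j\<in>Small. x j + c)" by (intro sum.cong) (auto simp: q_def Small_def)
    then show ?thesis using Small k by (simp add: sum.distrib P_def Y_def of_nat_diff)
  qed
  have alive': "processed (A I2) j \<tau>' < proc_time I2 j" if "j < n + k" for j
  proof -
    have "j < n \<or> j = l \<or> j \<in> Small" using that by (auto simp: Small_def New_def)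
    then consider "j < n" | "j = l" | "j \<in> Small" by blast
    then show ?thesis
    proof cases
      case 1
      then have "processed (A I2) j \<tau>' \<le> processed (A I) j \<tau> + (\<tau>' - \<tau>)"
        using processed_diff_le[OF S2 \<tau> \<open>\<tau> \<le> \<tau>'\<close>, of j] by (simp add: same_old)
      also have "\<dots> < proc_time I j" using \<tau>H \<mu>_le[OF 1] H\<mu> by simp
      finally show ?thesis using 1 by (simp add: I2_def inst_def)
    next
      case 2
      have "processed (A I2) l \<tau> = 0"
        using l by (intro processed_at_release[OF S2 \<tau>]) (auto simp: New_def I2_def inst_def)
      then have "processed (A I2) l \<tau>' \<le> \<tau>' - \<tau>"
        using processed_diff_le[OF S2 \<tau> \<open>\<tau> \<le> \<tau>'\<close>, of l] by simp
      then show ?thesis using 2 \<tau>H l by (auto simp: New_def I2_def inst_def q_def)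
    next
      case 3
      have "processed (A I2) j \<tau>' \<le> x j + (\<tau>' - (\<tau> + T))"
        using processed_diff_le[OF S2 _ \<tau>'(1), of j] \<tau> T by (simp add: same_new)
      then show ?thesis using 3 \<tau>' by (auto simp: New_def Small_def I2_def inst_def q_def)
    qed
  qed
  define E' where "E' = E \<union> Small"
  define a' where "a' j = (if j < n then a j else seq_start \<tau> q Small j)" for j
  have En: "E \<subseteq> {..<n}" using early J by (simp add: early_schedule_def)
  have SmallN: "n \<le> j" "j < n + k" if "j \<in> Small" for j using that by (auto simp: Small_def New_def)
  have q0': "0 \<le> q j" for j using q0[of j] by simp
  have ge: "\<tau> \<le> seq_start \<tau> q Small j" for j by (intro seq_start_ge q0')
  have old: "a' j = a j" "proc_time I2 j = proc_time I j" "release I2 j = release I j"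
      "release I j \<le> a j" "a j + proc_time I j \<le> \<tau>" if "j \<in> E" for j
    using that En early by (auto simp: a'_def I2_def inst_def early_schedule_def)
  have new: "a' j = seq_start \<tau> q Small j" "proc_time I2 j = q j" "release I2 j = \<tau>"
      "seq_start \<tau> q Small j + q j \<le> \<tau> + P" if "j \<in> Small" for j
    using SmallN[OF that] seq_start_end_le[where p = q and u = \<tau>, OF Small(1) q0' that]
    by (auto simp: a'_def I2_def inst_def sum_q)
  have early': "early_schedule I2 \<tau>' E' a'"
    unfolding early_schedule_def
  proof (intro conjI ballI impI)
    show "E' \<subseteq> jobs I2" using En SmallN by (auto simp: E'_def I2_def inst_def)
    fix j assume j: "j \<in> E'"
    show "release I2 j \<le> a' j" using j old[of j] new[of j] ge[of j] by (auto simp: E'_def)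
    show "a' j + proc_time I2 j \<le> \<tau>'"
      using j old[of j] new[of j] \<tau>' \<open>\<tau> \<le> \<tau>'\<close> by (auto simp: E'_def)
    fix i assume i: "i \<in> E'" and ij: "j \<noteq> i"
    consider "i \<in> E" "j \<in> E" | "i \<in> E" "j \<in> Small" | "i \<in> Small" "j \<in> E" | "i \<in> Small" "j \<in> Small"
      using i j by (auto simp: E'_def)
    then show "a' j + proc_time I2 j \<le> a' i \<or> a' i + proc_time I2 i \<le> a' j"
    proof cases
      case 1
      then show ?thesis using early ij by (simp add: early_schedule_def old)
    next
      case 2
      then show ?thesis using old[of i] new[of j] ge[of j] by auto
    next
      case 3
      then show ?thesis using old[of j] new[of i] ge[of i] by auto
    next
      case 4
      then show ?thesis
        using seq_start_disjoint[where p = q and u = \<tau>, OF Small(1) q0' 4(2,1) ij] by (simp add: new)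
    qed
  qed
  have "card E' = card E + card Small"
    unfolding E'_def using En SmallN Small finite_subset[OF En] by (intro card_Un_disjoint) fastforce+
  then have "card E' = (k - 1) * Suc m" by (simp add: cardE Small)
  moreover have "jobs I2 = {..<k * Suc m}" by (simp add: I2_def inst_def n_def add.commute)
  moreover have "release I2 j \<le> \<tau>'" if "j < n + k" for j
    using that rel[of j] \<open>\<tau> \<le> \<tau>'\<close> by (auto simp: I2_def inst_def)
  moreover have "k * Suc m = n + k" by (simp add: n_def)
  ultimately have "phase_state A k (Suc m) I2 \<tau>' E' a'"
    unfolding phase_state_def using I2 alive' early' \<tau> \<open>\<tau> \<le> \<tau>'\<close> by auto
  then show ?thesis by blast
qed

lemma phase_state_exists:
  assumes A: "clairvoyant_algorithm \<epsilon> A" and \<epsilon>: "0 < \<epsilon>" "\<epsilon> < 1"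
    and k: "2 \<le> k" "(real k - 1) * \<epsilon> < 1"
  shows "\<exists>I \<tau> E a. phase_state A k m I \<tau> E a"
proof (induction m)
  case 0
  have "phase_state A k 0 \<lparr>jobs = {}, release = (\<lambda>_. 0), proc_time = (\<lambda>_. 1)\<rparr> 0 {} (\<lambda>_. 0)"
    by (simp add: phase_state_def valid_instance_def early_schedule_def)
  then show ?case by blast
next
  case (Suc m)
  then show ?case using phase_step[OF assms] by blast
qed

text \<open>After \<open>m\<close> phases the algorithm has \<open>k * m\<close> jobs left and the
  optimum \<open>m\<close>. Long streams give \<open>k * m \<le> \<rho> * (m + 1)\<close>, and then
  \<open>m\<close> grows.\<close>

lemma deterministic_lower_bound:
  assumes A: "clairvoyant_algorithm \<epsilon> A" and \<epsilon>: "0 < \<epsilon>" "\<epsilon> < 1"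
    and k: "2 \<le> k" "(real k - 1) * \<epsilon> < 1"
    and comp: "competitive (ennreal \<rho>) (algorithm_cost A)" and \<rho>: "0 \<le> \<rho>"
  shows "real k \<le> \<rho>"
proof -
  have "real m * real k \<le> \<rho> * (1 + real m * 1)" for m
  proof -
    obtain I \<tau> E a where st: "phase_state A k m I \<tau> E a" using phase_state_exists[OF assms(1-5)] by blast
    define n where "n = k * m"
    have I: "valid_instance I" and J: "jobs I = {..<n}" and \<tau>: "0 \<le> \<tau>"
      and rel: "\<And>j. j < n \<Longrightarrow> release I j \<le> \<tau>"
      and alive: "\<And>j. j < n \<Longrightarrow> processed (A I) j \<tau> < proc_time I j"
      and early: "early_schedule I \<tau> E a" and cardE: "card E = (k - 1) * m"
      using st by (auto simp: phase_state_def n_def)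
    have En: "E \<subseteq> {..<n}" using early J by (simp add: early_schedule_def)
    have "card ({..<n} - E) = n - (k - 1) * m"
      using En cardE finite_subset[OF En] by (simp add: card_Diff_subset)
    also have "\<dots> = m" using k by (cases k) (auto simp: n_def)
    finally have late: "card ({..<n} - E) = m" .
    define G where "G = insert 1 ((\<lambda>j. proc_time I j - processed (A I) j \<tau>) ` {..<n})"
    \<comment> \<open>As \<open>\<delta>\<close> is at most every remaining amount of work, each old
      job accounts for \<open>\<delta>\<close> in every step: either it is unfinished, or finishing
      it took that much work.\<close>
    define \<delta> where "\<delta> = Min G"
    have "\<delta> \<in> G" unfolding \<delta>_def by (rule Min_in) (auto simp: G_def)
    then have \<delta>: "0 < \<delta>" using alive by (auto simp: G_def)
    have \<delta>_le: "\<delta> \<le> proc_time I j - processed (A I) j \<tau>" if "j < n" for j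
      unfolding \<delta>_def by (rule Min_le) (use that in \<open>auto simp: G_def\<close>)
    define c where "c = real n * (\<tau> + (\<Sum>j<n. proc_time I j))"
    have c0: "0 \<le> c"
      unfolding c_def using \<tau> I J by (auto intro!: mult_nonneg_nonneg add_nonneg_nonneg sum_nonneg simp: valid_instance_def less_imp_le)
    have "real N * (\<delta> * real n) \<le> \<rho> * (c + real N * ((real m + 1) * \<delta>))" for N
    proof -
      let ?I = "add_stream n \<tau> \<delta> N I"
      have I': "valid_instance ?I" by (rule add_stream_valid[OF I J \<tau> \<delta>])
      let ?S = "A ?I"
      note S = clairvoyant_valid_schedule[OF A I']
      have same: "processed ?S j \<tau> = processed (A I) j \<tau>" for j
      proof (rule indistinguishable_processed[OF A I I', symmetric])
      qed (use \<delta> in \<open>auto simp: J add_stream_def not_less add_increasing2\<close>)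
      have step: "\<delta> * n \<le> \<delta> * card {j. j < n \<and> processed ?S j (\<tau> + real (Suc i) * \<delta>) < proc_time I j} +
         (\<Sum>j<n. processed ?S j (\<tau> + real (Suc i) * \<delta>) - processed ?S j \<tau>)" for i
      proof -
        let ?t = "\<tau> + real (Suc i) * \<delta>"
        have t: "\<tau> \<le> ?t" using \<delta> by simp
        have "\<delta> * n = (\<Sum>j<n. \<delta>)" by simp
        also have "\<dots> \<le> (\<Sum>j<n. \<delta> * of_bool (processed ?S j ?t < proc_time I j) +
            (processed ?S j ?t - processed ?S j \<tau>))"
        proof (rule sum_mono)
          fix j assume "j \<in> {..<n}"
          then show "\<delta> \<le> \<delta> * of_bool (processed ?S j ?t < proc_time I j) +
            (processed ?S j ?t - processed ?S j \<tau>)"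
            using \<delta>_le[of j] processed_mono[OF S \<tau> t, of j] \<delta> by (auto simp: same)
        qed
        also have "\<dots> = \<delta> * (\<Sum>j<n. of_bool (processed ?S j ?t < proc_time I j)) +
            (\<Sum>j<n. processed ?S j ?t - processed ?S j \<tau>)"
          by (simp add: sum.distrib sum_distrib_left)
        also have "(\<Sum>j<n. of_bool (processed ?S j ?t < proc_time I j)) =
            real (card {j. j < n \<and> processed ?S j ?t < proc_time I j})"
          by (simp add: sum_of_bool_eq Int_def)
        finally show ?thesis .
      qed
      have "ennreal (real N * (\<delta> * real n)) = ennreal (\<Sum>i<N. \<delta> * real n)" by simp
      also have "\<dots> \<le> ennreal (\<Sum>i<N. \<delta> * card {j. j < n \<and> processed ?S j (\<tau> + real (Suc i) * \<delta>) < proc_time I j} +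
         (\<Sum>j<n. processed ?S j (\<tau> + real (Suc i) * \<delta>) - processed ?S j \<tau>))"
        by (intro ennreal_leI sum_mono step)
      also have "\<dots> \<le> algorithm_cost A ?I"
        unfolding algorithm_cost_def by (rule total_flow_add_stream_ge[OF I J \<tau> \<delta> rel S])
      also have "\<dots> \<le> ennreal \<rho> * opt_flow_time ?I"
        using comp I' by (simp add: competitive_def)
      also have "\<dots> \<le> ennreal \<rho> * ennreal (c + (real m + 1) * (real N * \<delta>))"
        using opt_add_stream_le[OF I J \<tau> \<delta> rel early, of N] unfolding late c_def by (intro mult_left_mono) auto
      also have "\<dots> = ennreal (\<rho> * (c + (real m + 1) * (real N * \<delta>)))"
        using \<rho> by (simp add: ennreal_mult')
      finally have "real N * (\<delta> * real n) \<le> \<rho> * (c + (real m + 1) * (real N * \<delta>))"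
        using \<rho> c0 \<delta> by (subst (asm) ennreal_le_iff) auto
      then show ?thesis by (simp add: algebra_simps)
    qed
    from le_of_affine_bounds[OF this] have "\<delta> * real n \<le> \<delta> * (\<rho> * (real m + 1))" by (simp add: algebra_simps)
    then have "real n \<le> \<rho> * (real m + 1)" using \<delta> by (simp only: mult_le_cancel_left_pos)
    then show ?thesis by (simp add: n_def algebra_simps)
  qed
  from le_of_affine_bounds[OF this] show ?thesis by simp
qed

section \<open>The distribution of sizes\<close>

text \<open>The recursion solves \<open>P(p \<le> I) = (E[p; p \<le> I] + (1 - 1 / r) * I * P(p > I)) / 2\<close> for the tails
  \<open>tail r I = P(p > I)\<close>: working on each job until it is finished or known to be longer than \<open>I\<close>
  yields exactly half a completion per unit of work, for every \<open>I\<close>.\<close>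

primrec tail :: "nat \<Rightarrow> nat \<Rightarrow> real" where
  "tail r 0 = 1"
| "tail r (Suc i) = tail r i * (real r - real i) / (2 * real r - 1 - real i)"

definition size_prob :: "nat \<Rightarrow> nat \<Rightarrow> real" where
  "size_prob r i = tail r (i - 1) - tail r i"

lemma tail_pos: "2 \<le> r \<Longrightarrow> i \<le> r \<Longrightarrow> 0 < tail r i"
  by (induction i) auto

lemma tail_eq_0: "tail r (Suc r) = 0"
  by simp

lemma tail_Suc_le:
  assumes "2 \<le> r" "i \<le> r"
  shows "tail r (Suc i) \<le> tail r i"
proof -
  have "tail r i * (real r - real i) \<le> tail r i * (2 * real r - 1 - real i)"
    using assms tail_pos[OF assms] by (intro mult_left_mono) auto
  then show ?thesis using assms by (simp add: divide_le_eq)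
qed

lemma size_prob_nonneg:
  assumes "2 \<le> r" "i \<in> {1..Suc r}"
  shows "0 \<le> size_prob r i"
  using tail_Suc_le[of r "i - 1"] assms by (cases i) (auto simp: size_prob_def simp del: tail.simps)

text \<open>The left side is the mean of the size truncated at \<open>I\<close>. Rearranged, this is
  the identity that the recursion for \<open>tail\<close> is made to solve.\<close>

lemma sum_tail:
  assumes "2 \<le> r" "I \<le> Suc r"
  shows "(\<Sum>i<I. tail r i) = 2 - 2 * tail r I + real I * tail r I / real r"
  using assms(2)
proof (induction I)
  case (Suc I)
  define d where "d = 2 * real r - 1 - real I"
  have d: "0 < d" using Suc assms by (simp add: d_def)
  have "tail r (Suc I) * d = tail r I * (real r - real I)" using d by (simp add: d_def)
  moreover have "(\<Sum>i<Suc I. tail r i) = 2 - tail r I * (real r - real I) / real r"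
    using Suc assms by (simp add: field_simps)
  moreover have "2 - 2 * tail r (Suc I) + real (Suc I) * tail r (Suc I) / real r
      = 2 - tail r (Suc I) * d / real r"
    using assms unfolding d_def by (simp add: field_simps del: tail.simps)
  ultimately show ?case by simp
qed simp

lemma sum_size_prob: "(\<Sum>i=1..I. size_prob r i) = 1 - tail r I"
  by (induction I) (simp_all add: size_prob_def del: tail.simps(2))

lemma sum_size_prob_weighted: "(\<Sum>i=1..I. size_prob r i * real i) = (\<Sum>i<I. tail r i) - real I * tail r I"
  by (induction I) (simp_all add: size_prob_def algebra_simps del: tail.simps(2))

text \<open>The mean work per job that the optimum has to do before the stream, where jobs of size
  \<open>r + 1\<close> are left out.\<close>

lemma size_mean_truncated:
  assumes "2 \<le> r"
  shows "(\<Sum>i=1..r. size_prob r i * real i) = 2 - (real r + 1) * tail r r"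
  using sum_tail[of r r] assms unfolding sum_size_prob_weighted by (simp add: algebra_simps)

text \<open>Here \<open>y i\<close> is the work done on a job if its size is \<open>i\<close>. The sizes that get revealed form an initial
  segment \<open>{1..I}\<close>, and all larger sizes receive the same amount of work, at least \<open>(1 - \<epsilon>) * I\<close>.\<close>

lemma job_potential_nonneg:
  assumes r: "2 \<le> r" and \<epsilon>: "0 < \<epsilon>" "real r * \<epsilon> \<le> 1"
    and hidden: "\<And>i i'. i \<in> {1..Suc r} \<Longrightarrow> i' \<in> {1..Suc r} \<Longrightarrow> i \<noteq> i' \<Longrightarrow>
      y i < (1 - \<epsilon>) * real i \<Longrightarrow> y i < (1 - \<epsilon>) * real i' \<Longrightarrow> y i' = y i"
    and y0: "\<And>i. 0 \<le> y i"
  shows "0 \<le> (\<Sum>i=1..Suc r. size_prob r i * (y i / 2 - of_bool (real i \<le> y i)))"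
proof -
  have \<epsilon>r: "1 - 1 / real r \<le> 1 - \<epsilon>" using r \<epsilon> by (simp add: field_simps)
  have "2 * \<epsilon> \<le> real r * \<epsilon>" using r \<epsilon> by (intro mult_right_mono) auto
  then have \<epsilon>1: "\<epsilon> < 1" using \<epsilon> by linarith
  have mono\<epsilon>: "(1 - \<epsilon>) * real i \<le> (1 - \<epsilon>) * real i'" if "i \<le> i'" for i i' :: nat
    using that \<epsilon>1 by (intro mult_left_mono) auto
  have less_id: "(1 - \<epsilon>) * real i \<le> real i" for i :: nat
    using \<epsilon> by (simp add: algebra_simps)
  obtain I where I: "I \<le> Suc r" and revealed: "\<And>i. i \<in> {1..I} \<Longrightarrow> (1 - \<epsilon>) * real i \<le> y i"
    and unrevealed: "\<And>i. i \<in> {Suc I..Suc r} \<Longrightarrow> (1 - \<epsilon>) * real I \<le> y i \<and> y i < real i"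
  proof -
    \<comment> \<open>The sizes that stay hidden. The revealed segment ends just before their
      minimum \<open>u\<close>, or contains all sizes if there are none.\<close>
    define U where "U = {i \<in> {1..Suc r}. y i < (1 - \<epsilon>) * real i}"
    have finU: "finite U" by (simp add: U_def)
    show ?thesis
    proof (cases "U = {}")
      case True
      then show ?thesis using that[of "Suc r"] by (force simp: U_def)
    next
      case False
      define u where "u = Min U"
      have u: "u \<in> U" unfolding u_def by (rule Min_in[OF finU False])
      have least: "i \<notin> U" if "i < u" for i using that Min_le[OF finU, of i] by (auto simp: u_def)
      have u1: "u \<in> {1..Suc r}" "y u < (1 - \<epsilon>) * real u" using u by (auto simp: U_def)
      \<comment> \<open>The work \<open>y u\<close> is below the threshold of \<open>u\<close> and
        thus of every larger size, which therefore cannot be told apart from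
        \<open>u\<close>.\<close>
      have const: "y i = y u" if i: "i \<in> {u..Suc r}" for i
      proof (cases "i = u")
        case False
        have "(1 - \<epsilon>) * real u \<le> (1 - \<epsilon>) * real i" using i by (intro mono\<epsilon>) simp
        then show ?thesis using hidden[of u i] u1 i False by auto
      qed simp
      have low: "(1 - \<epsilon>) * real (u - 1) \<le> y u"
      proof (cases "u = 1")
        case True
        then show ?thesis using y0[of u] by simp
      next
        case False
        then have v: "u - 1 \<in> {1..Suc r}" "u - 1 \<notin> U" using u1 least[of "u - 1"] by auto
        \<comment> \<open>Otherwise \<open>u - 1\<close> and \<open>u\<close> could not be told
          apart, and \<open>u - 1\<close> would be hidden too, against the minimality of
          \<open>u\<close>.\<close>
        show ?thesis
        proof (rule ccontr)
          assume *: "\<not> ?thesis"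
          then have "y (u - 1) = y u" using hidden[of u "u - 1"] u1 v by auto
          with * v show False by (auto simp: U_def)
        qed
      qed
      show ?thesis
      proof (rule that[of "u - 1"])
        show "u - 1 \<le> Suc r" using u1 by auto
        show "(1 - \<epsilon>) * real i \<le> y i" if "i \<in> {1..u - 1}" for i
        proof -
          from that u1 have "i < u" "i \<in> {1..Suc r}" by auto
          with least[of i] show ?thesis by (auto simp: U_def)
        qed
        fix i assume "i \<in> {Suc (u - 1)..Suc r}"
        then have i: "i \<in> {u..Suc r}" using u1 by auto
        have "y u < real i" using u1(2) less_id[of u] i by auto
        then show "(1 - \<epsilon>) * real (u - 1) \<le> y i \<and> y i < real i"
          using const[OF i] low by simp
      qed
    qed
  qed
  let ?g = "\<lambda>i. y i / 2 - of_bool (real i \<le> y i)"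
  \<comment> \<open>A completion costs two units of work in the potential. Leaving a revealed job
    unfinished saves at most \<open>\<epsilon> * i \<le> \<epsilon> * (2 * r) \<le> 2\<close> units,
    so it is no cheaper than completing it.\<close>
  have g1: "real i / 2 - 1 \<le> ?g i" if i: "i \<in> {1..I}" for i
  proof (cases "real i \<le> y i")
    case False
    have "\<epsilon> * real i \<le> \<epsilon> * (2 * real r)" using i I r \<epsilon> by (intro mult_left_mono) auto
    also have "\<dots> = 2 * (real r * \<epsilon>)" by simp
    also have "\<dots> \<le> 2" using \<epsilon> by simp
    finally show ?thesis using False revealed[OF i] by (simp add: algebra_simps)
  qed simp
  have g2: "(1 - 1 / real r) * real I / 2 \<le> ?g i" if i: "i \<in> {Suc I..Suc r}" for i
  proof -
    have "(1 - 1 / real r) * real I \<le> (1 - \<epsilon>) * real I" using \<epsilon>r by (intro mult_right_mono) auto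
    then show ?thesis using unrevealed[OF i] by simp
  qed
  have split: "{1..Suc r} = {1..I} \<union> {Suc I..Suc r}" using I by auto
  have sum_split: "(\<Sum>i=1..Suc r. f i) = (\<Sum>i=1..I. f i) + (\<Sum>i=Suc I..Suc r. f i)" for f :: "nat \<Rightarrow> real"
    unfolding split by (rule sum.union_disjoint) auto
  have rest: "(\<Sum>i=Suc I..Suc r. size_prob r i) = tail r I"
    using sum_split[of "size_prob r"] unfolding sum_size_prob tail_eq_0 by simp
  \<comment> \<open>By \<open>sum_tail\<close>, the bounds \<open>g1\<close> and \<open>g2\<close>
    average to exactly zero, whatever \<open>I\<close> is.\<close>
  have "0 = (\<Sum>i=1..I. size_prob r i * (real i / 2 - 1)) + tail r I * ((1 - 1 / real r) * real I / 2)"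
  proof -
    have "(\<Sum>i=1..I. size_prob r i * (real i / 2 - 1))
        = (\<Sum>i=1..I. size_prob r i * real i) / 2 - (\<Sum>i=1..I. size_prob r i)"
      by (simp add: right_diff_distrib sum_subtractf sum_divide_distrib)
    also have "\<dots> = (2 - 2 * tail r I + real I * tail r I / real r - real I * tail r I) / 2 - (1 - tail r I)"
      by (simp only: sum_size_prob_weighted sum_size_prob sum_tail[OF r I])
    finally show ?thesis using r by (simp add: field_simps)
  qed
  also have "\<dots> = (\<Sum>i=1..I. size_prob r i * (real i / 2 - 1)) +
      (\<Sum>i=Suc I..Suc r. size_prob r i * ((1 - 1 / real r) * real I / 2))"
    by (simp only: rest[symmetric] sum_distrib_right)
  also have "\<dots> \<le> (\<Sum>i=1..I. size_prob r i * ?g i) + (\<Sum>i=Suc I..Suc r. size_prob r i * ?g i)"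
    using I by (intro add_mono sum_mono mult_left_mono g1 g2 size_prob_nonneg[OF r]) auto
  also have "\<dots> = (\<Sum>i=1..Suc r. size_prob r i * ?g i)" by (rule sum_split[symmetric])
  finally show ?thesis .
qed

section \<open>Expectations over finitely many independent coordinates\<close>

definition prod_expectation ::
    "('b \<Rightarrow> real) \<Rightarrow> 'b set \<Rightarrow> 'a set \<Rightarrow> (('a \<Rightarrow> 'b) \<Rightarrow> real) \<Rightarrow> real" where
  "prod_expectation w V F f = (\<Sum>g\<in>PiE F (\<lambda>_. V). (\<Prod>j\<in>F. w (g j)) * f g)"

text \<open>Fubini for a single coordinate: \<open>j\<close> is averaged first, with all others
  fixed.\<close>

lemma prod_expectation_insert:
  assumes "finite F" "j \<notin> F"
  shows "prod_expectation w V (insert j F) f = prod_expectation w V F (\<lambda>g. \<Sum>i\<in>V. w i * f (g(j := i)))"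
proof -
  have "prod_expectation w V (insert j F) f
     = (\<Sum>(i, g)\<in>V \<times> PiE F (\<lambda>_. V). (\<Prod>h\<in>insert j F. w ((g(j := i)) h)) * f (g(j := i)))"
    unfolding prod_expectation_def PiE_insert_eq
    using assms by (subst sum.reindex[OF inj_combinator]) (auto simp: case_prod_unfold)
  also have "\<dots> = (\<Sum>(i, g)\<in>V \<times> PiE F (\<lambda>_. V). w i * (\<Prod>h\<in>F. w (g h)) * f (g(j := i)))"
  proof (intro sum.cong refl, clarify)
    fix i g
    have "(\<Prod>h\<in>F. w ((g(j := i)) h)) = (\<Prod>h\<in>F. w (g h))" using assms by (intro prod.cong) auto
    then show "(\<Prod>h\<in>insert j F. w ((g(j := i)) h)) * f (g(j := i)) = w i * (\<Prod>h\<in>F. w (g h)) * f (g(j := i))"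
      using assms by simp
  qed
  also have "\<dots> = (\<Sum>g\<in>PiE F (\<lambda>_. V). \<Sum>i\<in>V. w i * (\<Prod>h\<in>F. w (g h)) * f (g(j := i)))"
    by (subst sum.swap) (simp add: sum.cartesian_product)
  also have "\<dots> = prod_expectation w V F (\<lambda>g. \<Sum>i\<in>V. w i * f (g(j := i)))"
    by (simp add: prod_expectation_def sum_distrib_left algebra_simps)
  finally show ?thesis .
qed

lemma prod_expectation_add:
  "prod_expectation w V F (\<lambda>g. f g + h g) = prod_expectation w V F f + prod_expectation w V F h"
  by (simp add: prod_expectation_def distrib_left sum.distrib)

lemma prod_expectation_cmult:
  "prod_expectation w V F (\<lambda>g. c * f g) = c * prod_expectation w V F f"
  by (simp add: prod_expectation_def sum_distrib_left algebra_simps)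

lemma prod_expectation_sum:
  "prod_expectation w V F (\<lambda>g. \<Sum>i\<in>K. f i g) = (\<Sum>i\<in>K. prod_expectation w V F (f i))"
  unfolding prod_expectation_def sum_distrib_left by (rule sum.swap)

lemma prod_weight_nonneg:
  fixes w :: "'b \<Rightarrow> real"
  assumes "\<And>i. i \<in> V \<Longrightarrow> 0 \<le> w i" "g \<in> PiE F (\<lambda>_. V)"
  shows "0 \<le> (\<Prod>j\<in>F. w (g j))"
  using assms by (intro prod_nonneg) (auto simp: PiE_iff)

lemma ennreal_prod_expectation:
  assumes w: "\<And>i. i \<in> V \<Longrightarrow> 0 \<le> w i" and f: "\<And>g. g \<in> PiE F (\<lambda>_. V) \<Longrightarrow> 0 \<le> f g"
  shows "ennreal (prod_expectation w V F f)
    = (\<Sum>g\<in>PiE F (\<lambda>_. V). ennreal (\<Prod>j\<in>F. w (g j)) * ennreal (f g))"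
proof -
  have "(\<Sum>g\<in>PiE F (\<lambda>_. V). ennreal (\<Prod>j\<in>F. w (g j)) * ennreal (f g))
      = (\<Sum>g\<in>PiE F (\<lambda>_. V). ennreal ((\<Prod>j\<in>F. w (g j)) * f g))"
    by (rule sum.cong[OF refl], rule ennreal_mult[symmetric]) (rule prod_weight_nonneg[OF w] f; assumption)+
  also have "\<dots> = ennreal (prod_expectation w V F f)"
    unfolding prod_expectation_def
    by (rule sum_ennreal, rule mult_nonneg_nonneg) (rule prod_weight_nonneg[OF w] f; assumption)+
  finally show ?thesis ..
qed

lemma prod_expectation_mono:
  assumes "\<And>i. i \<in> V \<Longrightarrow> 0 \<le> w i" "\<And>g. g \<in> PiE F (\<lambda>_. V) \<Longrightarrow> f g \<le> h g"
  shows "prod_expectation w V F f \<le> prod_expectation w V F h"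
  unfolding prod_expectation_def using assms by (intro sum_mono mult_left_mono prod_weight_nonneg)

lemma prod_expectation_const:
  assumes "finite F" "(\<Sum>i\<in>V. w i) = (1::real)"
  shows "prod_expectation w V F (\<lambda>_. c) = c"
  using assms(1)
proof (induction F)
  case (insert j F)
  then show ?case by (simp add: prod_expectation_insert sum_distrib_right[symmetric] assms(2))
qed (simp add: prod_expectation_def)

lemma prod_expectation_coordinate:
  assumes "finite F" "j \<in> F" "(\<Sum>i\<in>V. w i) = (1::real)"
  shows "prod_expectation w V F (\<lambda>g. f (g j)) = (\<Sum>i\<in>V. w i * f i)"
proof -
  have "F = insert j (F - {j})" using assms by auto
  then have "prod_expectation w V F (\<lambda>g. f (g j)) = prod_expectation w V (F - {j}) (\<lambda>g. \<Sum>i\<in>V. w i * f i)"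
    using prod_expectation_insert[of "F - {j}" j w V "\<lambda>g. f (g j)"] assms by simp
  then show ?thesis using assms by (simp add: prod_expectation_const)
qed

text \<open>Averaging over coordinate \<open>j\<close> first leaves a nonnegative function of the
  others. This reduces a claim about a random instance to one about the random size of a single
  job.\<close>

lemma prod_expectation_resample_nonneg:
  assumes "finite F" "j \<in> F" "\<And>i. i \<in> V \<Longrightarrow> 0 \<le> w i"
    and "\<And>g. g \<in> PiE (F - {j}) (\<lambda>_. V) \<Longrightarrow> 0 \<le> (\<Sum>i\<in>V. w i * f (g(j := i)))"
  shows "0 \<le> prod_expectation w V F f"
proof -
  have "F = insert j (F - {j})" using assms by auto
  then have "prod_expectation w V F f = prod_expectation w V (F - {j}) (\<lambda>g. \<Sum>i\<in>V. w i * f (g(j := i)))"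
    using prod_expectation_insert[of "F - {j}" j w V f] assms by simp
  also have "\<dots> \<ge> 0"
    unfolding prod_expectation_def
  proof (rule sum_nonneg)
    fix g assume g: "g \<in> PiE (F - {j}) (\<lambda>_. V)"
    show "0 \<le> (\<Prod>h\<in>F - {j}. w (g h)) * (\<Sum>i\<in>V. w i * f (g(j := i)))"
      by (rule mult_nonneg_nonneg[OF prod_weight_nonneg[OF assms(3) g] assms(4)[OF g]])
  qed
  finally show ?thesis .
qed

text \<open>Additivity of the variance: the mixed terms vanish because \<open>h\<close> has mean
  zero.\<close>

lemma prod_expectation_square_sum:
  assumes "finite F" "(\<Sum>i\<in>V. w i) = (1::real)" "(\<Sum>i\<in>V. w i * h i) = 0"
  shows "prod_expectation w V F (\<lambda>g. (\<Sum>j\<in>F. h (g j))\<^sup>2) = real (card F) * (\<Sum>i\<in>V. w i * (h i)\<^sup>2)"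
  using assms(1)
proof (induction F)
  case (insert j F)
  let ?v = "\<Sum>i\<in>V. w i * (h i)\<^sup>2"
  have inner: "(\<Sum>i\<in>V. w i * (\<Sum>l\<in>insert j F. h ((g(j := i)) l))\<^sup>2) = ?v + (\<Sum>l\<in>F. h (g l))\<^sup>2" for g
  proof -
    define z where "z = (\<Sum>l\<in>F. h (g l))"
    have "(\<Sum>l\<in>F. h ((g(j := i)) l)) = z" for i
      unfolding z_def using insert by (intro sum.cong) auto
    then have "(\<Sum>i\<in>V. w i * (\<Sum>l\<in>insert j F. h ((g(j := i)) l))\<^sup>2) = (\<Sum>i\<in>V. w i * (h i + z)\<^sup>2)"
      using insert by simp
    also have "\<dots> = (\<Sum>i\<in>V. w i * (h i)\<^sup>2 + 2 * z * (w i * h i) + z\<^sup>2 * w i)"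
      by (intro sum.cong) (auto simp: power2_eq_square algebra_simps)
    also have "\<dots> = ?v + 2 * z * (\<Sum>i\<in>V. w i * h i) + z\<^sup>2 * (\<Sum>i\<in>V. w i)"
      by (simp add: sum.distrib sum_distrib_left)
    finally show ?thesis by (simp add: assms z_def)
  qed
  have "prod_expectation w V (insert j F) (\<lambda>g. (\<Sum>l\<in>insert j F. h (g l))\<^sup>2)
     = prod_expectation w V F (\<lambda>g. ?v + (\<Sum>l\<in>F. h (g l))\<^sup>2)"
    unfolding prod_expectation_insert[OF insert(1,2)] by (simp only: inner)
  then show ?case
    using insert by (simp add: prod_expectation_add prod_expectation_const assms(2) algebra_simps)
qed (simp add: prod_expectation_def)

section \<open>Randomized algorithms\<close>

definition batch :: "nat \<Rightarrow> (nat \<Rightarrow> nat) \<Rightarrow> sched_instance" where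
  "batch n g = \<lparr>jobs = {..<n}, release = (\<lambda>_. 0), proc_time = (\<lambda>j. real (g j))\<rparr>"

lemma batch_valid: "(\<And>j. j < n \<Longrightarrow> 0 < g j) \<Longrightarrow> valid_instance (batch n g)"
  by (simp add: batch_def valid_instance_def)

text \<open>With the other sizes fixed, the runs for two sizes of \<open>j\<close> agree as long as
  the work on \<open>j\<close> reveals neither size. This supplies the hypothesis
  \<open>hidden\<close> of \<open>job_potential_nonneg\<close>.\<close>

lemma batch_potential_nonneg:
  assumes A: "clairvoyant_algorithm \<epsilon> A" and \<epsilon>: "0 < \<epsilon>" "real r * \<epsilon> \<le> 1" and r: "2 \<le> r"
    and \<tau>: "0 \<le> \<tau>" and \<delta>: "0 < \<delta>" and j: "j < n"
  shows "0 \<le> prod_expectation (size_prob r) {1..Suc r} {..<n}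
     (\<lambda>g. processed (A (add_stream n \<tau> \<delta> N (batch n g))) j t / 2 -
        of_bool (real (g j) \<le> processed (A (add_stream n \<tau> \<delta> N (batch n g))) j t))"
proof (rule prod_expectation_resample_nonneg)
  fix g assume g: "g \<in> PiE ({..<n} - {j}) (\<lambda>_. {1..Suc r})"
  let ?I = "\<lambda>i. add_stream n \<tau> \<delta> N (batch n (g(j := i)))"
  let ?y = "\<lambda>i. processed (A (?I i)) j t"
  have valid: "valid_instance (?I i)" if "i \<in> {1..Suc r}" for i
  proof (rule add_stream_valid[OF batch_valid _ \<tau> \<delta>])
    fix h assume "h < n"
    then show "0 < (g(j := i)) h" using g that by (cases "h = j") (force simp: PiE_iff)+
  qed (simp add: batch_def)
  have "0 \<le> (\<Sum>i=1..Suc r. size_prob r i * (?y i / 2 - of_bool (real i \<le> ?y i)))"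
  proof (rule job_potential_nonneg[OF r \<epsilon>])
    fix i i' assume i: "i \<in> {1..Suc r}" "i' \<in> {1..Suc r}"
      and y: "?y i < (1 - \<epsilon>) * real i" "?y i < (1 - \<epsilon>) * real i'"
    show "?y i' = ?y i"
      by (rule indistinguishable_processed[OF A valid valid, symmetric, OF i])
         (use y in \<open>auto simp: add_stream_def batch_def split: if_splits\<close>)
  qed (rule processed_nonneg)
  then show "0 \<le> (\<Sum>i\<in>{1..Suc r}. size_prob r i * (?y i / 2 - of_bool (real ((g(j := i)) j) \<le> ?y i)))"
    by simp
qed (use j size_prob_nonneg[OF r] in auto)

text \<open>Size 2 of the stream jobs matches the exchange rate of the potential, two units of work
  per completion. A step counts \<open>2 * n\<close>, minus 2 per finished job, plus the work since
  \<open>\<tau>\<close>. In expectation the total work pays for the completions, and at most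
  \<open>\<tau>\<close> of it was done before the stream.\<close>

lemma batch_flow_lower:
  assumes A: "clairvoyant_algorithm \<epsilon> A" and \<epsilon>: "0 < \<epsilon>" "real r * \<epsilon> \<le> 1" and r: "2 \<le> r" and \<tau>: "0 \<le> \<tau>"
  shows "ennreal (real N * (2 * real n - \<tau>)) \<le>
    (\<Sum>g\<in>PiE {..<n} (\<lambda>_. {1..Suc r}). ennreal (\<Prod>j<n. size_prob r (g j)) *
       total_flow_time (add_stream n \<tau> 2 N (batch n g)) (A (add_stream n \<tau> 2 N (batch n g))))"
proof -
  let ?V = "{1..Suc r}" and ?w = "size_prob r" and ?I = "\<lambda>g. add_stream n \<tau> 2 N (batch n g)"
  let ?G = "PiE {..<n} (\<lambda>_. ?V)"
  let ?E = "prod_expectation ?w ?V {..<n}"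
  define y where "y g j i = processed (A (?I g)) j (\<tau> + real (Suc i) * 2)" for g j i
  define cost where "cost g = (\<Sum>i<N. 2 * card {j. j < n \<and> y g j i < real (g j)} +
       (\<Sum>j<n. y g j i - processed (A (?I g)) j \<tau>))" for g
  have w0: "0 \<le> ?w i" if "i \<in> ?V" for i using size_prob_nonneg[OF r that] .
  have w1: "(\<Sum>i\<in>?V. ?w i) = 1" unfolding sum_size_prob tail_eq_0 by simp
  have gpos: "0 < g j" if "g \<in> ?G" "j < n" for g j using that by (force simp: PiE_iff)
  have base: "valid_instance (batch n g)" if "g \<in> ?G" for g using gpos[OF that] by (intro batch_valid)
  have valid: "valid_instance (?I g)" if "g \<in> ?G" for g
    by (rule add_stream_valid[OF base[OF that] _ \<tau>]) (auto simp: batch_def)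
  note S = clairvoyant_valid_schedule[OF A valid]
  have cost0: "0 \<le> cost g" if "g \<in> ?G" for g
    unfolding cost_def y_def using processed_mono[OF S[OF that] \<tau>] \<tau>
    by (auto intro!: sum_nonneg add_nonneg_nonneg)
  have cost_le: "ennreal (cost g) \<le> total_flow_time (?I g) (A (?I g))" if g: "g \<in> ?G" for g
    using total_flow_add_stream_ge[OF base[OF g] _ \<tau> _ _ S[OF g]] \<tau>
    by (simp add: cost_def y_def batch_def)
  have cost_ge: "(\<Sum>i<N. 2 * real n - \<tau> + 2 * (\<Sum>j<n. y g j i / 2 - of_bool (real (g j) \<le> y g j i))) \<le> cost g"
    if g: "g \<in> ?G" for g
    unfolding cost_def
  proof (rule sum_mono)
    fix i
    have "real (card {j. j < n \<and> y g j i < real (g j)}) = (\<Sum>j<n. of_bool (y g j i < real (g j)))"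
      by (simp add: sum_of_bool_eq Int_def)
    also have "\<dots> = (\<Sum>j<n. 1 - of_bool (real (g j) \<le> y g j i))" by (intro sum.cong) auto
    also have "\<dots> = real n - (\<Sum>j<n. of_bool (real (g j) \<le> y g j i))" by (simp add: sum_subtractf)
    finally have "real (card {j. j < n \<and> y g j i < real (g j)}) = real n - (\<Sum>j<n. of_bool (real (g j) \<le> y g j i))" .
    moreover have "(\<Sum>j<n. processed (A (?I g)) j \<tau>) \<le> \<tau>" using sum_processed_le[OF S[OF g] \<tau>] by simp
    ultimately show "2 * real n - \<tau> + 2 * (\<Sum>j<n. y g j i / 2 - of_bool (real (g j) \<le> y g j i))
       \<le> 2 * card {j. j < n \<and> y g j i < real (g j)} + (\<Sum>j<n. y g j i - processed (A (?I g)) j \<tau>)"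
      by (simp add: sum_subtractf sum_divide_distrib[symmetric])
  qed
  have "real N * (2 * real n - \<tau>) \<le> (\<Sum>i<N. 2 * real n - \<tau> +
       2 * (\<Sum>j<n. ?E (\<lambda>g. y g j i / 2 - of_bool (real (g j) \<le> y g j i))))"
  proof -
    have "0 \<le> (\<Sum>j<n. ?E (\<lambda>g. y g j i / 2 - of_bool (real (g j) \<le> y g j i)))" for i
      unfolding y_def by (intro sum_nonneg batch_potential_nonneg[OF A \<epsilon> r \<tau>]) auto
    then have "(\<Sum>i<N. 2 * real n - \<tau>) \<le> (\<Sum>i<N. 2 * real n - \<tau> +
       2 * (\<Sum>j<n. ?E (\<lambda>g. y g j i / 2 - of_bool (real (g j) \<le> y g j i))))"
      by (intro sum_mono) simp
    then show ?thesis by simp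
  qed
  also have "\<dots> = ?E (\<lambda>g. \<Sum>i<N. 2 * real n - \<tau> + 2 * (\<Sum>j<n. y g j i / 2 - of_bool (real (g j) \<le> y g j i)))"
    by (simp only: prod_expectation_sum prod_expectation_add prod_expectation_cmult
        prod_expectation_const[OF finite_lessThan w1])
  also have "\<dots> \<le> ?E cost" by (intro prod_expectation_mono w0 cost_ge)
  finally have "ennreal (real N * (2 * real n - \<tau>)) \<le> ennreal (?E cost)" by (rule ennreal_leI)
  also have "\<dots> = (\<Sum>g\<in>?G. ennreal (\<Prod>j<n. ?w (g j)) * ennreal (cost g))"
    by (rule ennreal_prod_expectation[OF w0 cost0])
  also have "\<dots> \<le> (\<Sum>g\<in>?G. ennreal (\<Prod>j<n. ?w (g j)) * total_flow_time (?I g) (A (?I g)))"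
    by (intro sum_mono mult_left_mono cost_le) auto
  finally show ?thesis .
qed

text \<open>If the jobs of size at most \<open>r\<close> do not fit before \<open>\<tau>\<close>, the whole batch is postponed until after the
  stream; the squared deviation pays for this as in Chebyshev's inequality.\<close>

lemma batch_opt_le:
  assumes \<eta>: "0 < \<eta>" and n: "0 < n" and \<mu>0: "0 \<le> \<mu>"
    and g: "g \<in> PiE {..<n} (\<lambda>_. {1..Suc r})" and \<tau>: "\<tau> = real n * (\<mu> + \<eta>)"
    and h: "h = (\<lambda>i. (if i \<le> r then real i else 0) - \<mu>)"
  shows "opt_flow_time (add_stream n \<tau> 2 N (batch n g)) \<le>
    ennreal (real n * (\<tau> + real n * real (Suc r)) + 2 * real N * ((\<Sum>j<n. of_bool (g j = Suc r)) +
       1 / (real n * \<eta>\<^sup>2) * (\<Sum>j<n. h (g j))\<^sup>2 + 1))"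
proof -
  have gpos: "0 < g j" "g j \<le> Suc r" if "j < n" for j using that g by (force simp: PiE_iff)+
  have base: "valid_instance (batch n g)" using gpos by (intro batch_valid)
  have \<tau>0: "0 \<le> \<tau>" unfolding \<tau> using \<mu>0 \<eta> by simp
  define X where "X = (\<Sum>j | j < n \<and> g j \<le> r. real (g j))"
  define E where "E = (if X \<le> \<tau> then {j. j < n \<and> g j \<le> r} else {})"
  have finE: "finite E" by (simp add: E_def)
  have "early_schedule (batch n g) \<tau> E (seq_start 0 (\<lambda>j. real (g j)) E)"
    unfolding early_schedule_def
  proof (intro conjI ballI impI)
    show "E \<subseteq> jobs (batch n g)" by (auto simp: E_def batch_def)
    fix j assume j: "j \<in> E"
    show "release (batch n g) j \<le> seq_start 0 (\<lambda>j. real (g j)) E j"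
      by (simp add: batch_def seq_start_ge)
    have "(\<Sum>j\<in>E. real (g j)) \<le> \<tau>" using \<tau>0 by (simp add: E_def X_def)
    then show "seq_start 0 (\<lambda>j. real (g j)) E j + proc_time (batch n g) j \<le> \<tau>"
      using seq_start_end_le[where p = "\<lambda>j. real (g j)" and u = 0, OF finE _ j] by (simp add: batch_def)
    fix i assume "i \<in> E" "j \<noteq> i"
    then show "seq_start 0 (\<lambda>j. real (g j)) E j + proc_time (batch n g) j \<le> seq_start 0 (\<lambda>j. real (g j)) E i \<or>
        seq_start 0 (\<lambda>j. real (g j)) E i + proc_time (batch n g) i \<le> seq_start 0 (\<lambda>j. real (g j)) E j"
      using seq_start_disjoint[where p = "\<lambda>j. real (g j)" and u = 0, OF finE _ j] by (simp add: batch_def)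
  qed
  then have "opt_flow_time (add_stream n \<tau> 2 N (batch n g)) \<le>
    ennreal (real n * (\<tau> + (\<Sum>j<n. real (g j))) + (real (card ({..<n} - E)) + 1) * (real N * 2))"
    using opt_add_stream_le[OF base _ \<tau>0, of n 2 E "seq_start 0 (\<lambda>j. real (g j)) E" N] \<tau>0
    by (simp add: batch_def)
  moreover have "(\<Sum>j<n. real (g j)) \<le> real n * real (Suc r)"
    using sum_bounded_above[of "{..<n}" "\<lambda>j. real (g j)" "real (Suc r)"] gpos(2) by fastforce
  then have "real n * (\<tau> + (\<Sum>j<n. real (g j))) \<le> real n * (\<tau> + real n * real (Suc r))"
    by (intro mult_left_mono) auto
  moreover have "real (card ({..<n} - E)) \<le> (\<Sum>j<n. of_bool (g j = Suc r)) +
       1 / (real n * \<eta>\<^sup>2) * (\<Sum>j<n. h (g j))\<^sup>2"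
  proof (cases "X \<le> \<tau>")
    case True
    \<comment> \<open>Everything of size at most \<open>r\<close> fits before \<open>\<tau>\<close>,
      so exactly the jobs of size \<open>r + 1\<close> are late.\<close>
    have "{..<n} - E = {..<n} \<inter> {j. g j = Suc r}" using True gpos(2) by (force simp: E_def)
    then have "real (card ({..<n} - E)) = (\<Sum>j<n. of_bool (g j = Suc r))"
      by (simp add: sum_of_bool_eq)
    moreover have "0 \<le> 1 / (real n * \<eta>\<^sup>2) * (\<Sum>j<n. h (g j))\<^sup>2" by simp
    ultimately show ?thesis by simp
  next
    case False
    have "(\<Sum>j<n. h (g j)) = X - real n * \<mu>"
      unfolding h X_def by (simp add: sum_subtractf sum.If_cases Int_def)
    then have "real n * \<eta> \<le> (\<Sum>j<n. h (g j))" using False by (simp add: \<tau> algebra_simps)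
    then have "(real n * \<eta>)\<^sup>2 \<le> (\<Sum>j<n. h (g j))\<^sup>2" using \<eta> by (intro power_mono) auto
    \<comment> \<open>The deviation is at least \<open>n * \<eta>\<close>, so the squared term alone
      covers all \<open>n\<close> postponed jobs.\<close>
    then have "1 / (real n * \<eta>\<^sup>2) * (real n * \<eta>)\<^sup>2 \<le> 1 / (real n * \<eta>\<^sup>2) * (\<Sum>j<n. h (g j))\<^sup>2"
      by (intro mult_left_mono) auto
    moreover have "1 / (real n * \<eta>\<^sup>2) * (real n * \<eta>)\<^sup>2 = real n"
      using n \<eta> by (simp add: power2_eq_square)
    moreover have "real (card ({..<n} - E)) = real n" using False by (simp add: E_def)
    moreover have "0 \<le> (\<Sum>j<n. of_bool (g j = Suc r) :: real)" by (intro sum_nonneg) simp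
    ultimately show ?thesis by linarith
  qed
  then have "(real (card ({..<n} - E)) + 1) * (real N * 2) \<le> ((\<Sum>j<n. of_bool (g j = Suc r)) +
       1 / (real n * \<eta>\<^sup>2) * (\<Sum>j<n. h (g j))\<^sup>2 + 1) * (real N * 2)"
    by (intro mult_right_mono) auto
  ultimately show ?thesis
    by (smt (verit) ennreal_leI mult.commute mult.left_commute order_trans)
qed

text \<open>Yao's principle: \<open>batch_flow_lower\<close> holds for every algorithm in
  \<open>space M\<close>, so integrating over \<open>M\<close> and exchanging the integral with the
  finite average over instances contrasts it with the competitive bound.\<close>

lemma randomized_lower_bound:
  assumes M: "randomized_clairvoyant_algorithm \<epsilon> M" and \<epsilon>: "0 < \<epsilon>" "real r * \<epsilon> \<le> 1" and r: "2 \<le> r"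
    and comp: "competitive (ennreal \<rho>) (expected_cost M)" and \<rho>: "0 \<le> \<rho>"
  shows "real r / 2 \<le> \<rho>"
proof -
  let ?V = "{1..Suc r}" and ?w = "size_prob r"
  interpret prob_space M using M by (simp add: randomized_clairvoyant_algorithm_def)
  define Q where "Q = tail r r"
  define \<mu> where "\<mu> = (\<Sum>i=1..r. ?w i * real i)"
  define h where "h = (\<lambda>i. (if i \<le> r then real i else 0) - \<mu>)"
  define v where "v = (\<Sum>i\<in>?V. ?w i * (h i)\<^sup>2)"
  have Q: "0 < Q" unfolding Q_def using r by (intro tail_pos) auto
  have w0: "0 \<le> ?w i" if "i \<in> ?V" for i using size_prob_nonneg[OF r that] .
  have w1: "(\<Sum>i\<in>?V. ?w i) = 1" unfolding sum_size_prob tail_eq_0 by simp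
  have wtop: "?w (Suc r) = Q" by (simp add: size_prob_def Q_def)
  have \<mu>: "\<mu> = 2 - (real r + 1) * Q" unfolding \<mu>_def Q_def by (rule size_mean_truncated[OF r])
  have \<mu>0: "0 \<le> \<mu>" unfolding \<mu>_def by (intro sum_nonneg mult_nonneg_nonneg w0) auto
  have wh: "(\<Sum>i\<in>?V. ?w i * h i) = 0"
  proof -
    have "(\<Sum>i\<in>?V. ?w i * h i) = (\<Sum>i\<in>?V. ?w i * (if i \<le> r then real i else 0)) - (\<Sum>i\<in>?V. ?w i) * \<mu>"
      by (simp only: h_def right_diff_distrib sum_subtractf sum_distrib_right)
    also have "(\<Sum>i\<in>?V. ?w i * (if i \<le> r then real i else 0)) = \<mu>"
    proof -
      have "(\<Sum>i\<in>?V. ?w i * (if i \<le> r then real i else 0))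
          = (\<Sum>i=1..r. ?w i * (if i \<le> r then real i else 0))" by simp
      also have "\<dots> = \<mu>" unfolding \<mu>_def by (intro sum.cong) auto
      finally show ?thesis .
    qed
    finally show ?thesis unfolding w1 by simp
  qed
  have v0: "0 \<le> v" unfolding v_def by (intro sum_nonneg mult_nonneg_nonneg w0) auto
  \<comment> \<open>The left side is \<open>2 * n - \<tau>\<close> for
    \<open>\<tau> = n * (\<mu> + Q) = n * (2 - r * Q)\<close>. The Chebyshev term
    \<open>v / Q\<^sup>2\<close> does not depend on \<open>n\<close>, so for large \<open>n\<close>
    only the fraction \<open>Q\<close> of maximal jobs counts for the optimum.\<close>
  have "real n * (real r * Q) \<le> \<rho> * (2 * (v / Q\<^sup>2 + 1) + real n * (2 * Q))" for n
  proof (cases "n = 0")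
    case True
    then show ?thesis using \<rho> v0 by simp
  next
    case False
    then have n: "0 < n" by simp
    define \<tau> where "\<tau> = real n * (\<mu> + Q)"
    have \<tau>0: "0 \<le> \<tau>" unfolding \<tau>_def using \<mu>0 Q by simp
    let ?G = "PiE {..<n} (\<lambda>_. ?V)" and ?E = "prod_expectation ?w ?V {..<n}"
    define c where "c = real n * (\<tau> + real n * real (Suc r))"
    have c0: "0 \<le> c" unfolding c_def using \<tau>0 by simp
    have "real N * (2 * real n - \<tau>) \<le> \<rho> * (c + real N * (2 * (real n * Q + v / Q\<^sup>2 + 1)))" for N
    proof -
      let ?I = "\<lambda>g. add_stream n \<tau> 2 N (batch n g)"
      define u where "u g = c + 2 * real N * ((\<Sum>j<n. of_bool (g j = Suc r)) +
         1 / (real n * Q\<^sup>2) * (\<Sum>j<n. h (g j))\<^sup>2 + 1)" for g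
      have u0: "0 \<le> u g" for g unfolding u_def
        by (intro add_nonneg_nonneg mult_nonneg_nonneg sum_nonneg c0) auto
      have valid: "valid_instance (?I g)" if "g \<in> ?G" for g
        by (rule add_stream_valid[OF batch_valid _ \<tau>0]) (use that in \<open>force simp: PiE_iff batch_def\<close>)+
      have prod0: "0 \<le> (\<Prod>j<n. ?w (g j))" if "g \<in> ?G" for g by (intro prod_weight_nonneg[OF w0 that])
      have Eu: "?E u = c + real N * (2 * (real n * Q + v / Q\<^sup>2 + 1))"
      proof -
        have "?E u = c + 2 * real N * ((\<Sum>j<n. ?E (\<lambda>g. of_bool (g j = Suc r))) +
           1 / (real n * Q\<^sup>2) * ?E (\<lambda>g. (\<Sum>j<n. h (g j))\<^sup>2) + 1)"
          unfolding u_def by (simp only: prod_expectation_sum prod_expectation_add prod_expectation_cmult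
              prod_expectation_const[OF finite_lessThan w1])
        also have "?E (\<lambda>g. (\<Sum>j<n. h (g j))\<^sup>2) = real n * v"
          using prod_expectation_square_sum[OF finite_lessThan w1 wh] by (simp add: v_def)
        also have "(\<Sum>j<n. ?E (\<lambda>g. of_bool (g j = Suc r))) = (\<Sum>j<n. Q)"
        proof (rule sum.cong)
          fix j assume "j \<in> {..<n}"
          then have "?E (\<lambda>g. of_bool (g j = Suc r)) = (\<Sum>i\<in>?V. ?w i * of_bool (i = Suc r))"
            by (intro prod_expectation_coordinate finite_lessThan w1)
          also have "\<dots> = Q" by (simp add: wtop)
          finally show "?E (\<lambda>g. of_bool (g j = Suc r)) = Q" .
        qed simp
        finally show ?thesis using n Q by (simp add: field_simps)
      qed
      have "ennreal (real N * (2 * real n - \<tau>)) = (\<integral>\<^sup>+ A. ennreal (real N * (2 * real n - \<tau>)) \<partial>M)"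
        by (simp add: emeasure_space_1)
      also have "\<dots> \<le> (\<integral>\<^sup>+ A. (\<Sum>g\<in>?G. ennreal (\<Prod>j<n. ?w (g j)) * total_flow_time (?I g) (A (?I g))) \<partial>M)"
        using M by (intro nn_integral_mono batch_flow_lower[OF _ \<epsilon> r \<tau>0])
          (simp add: randomized_clairvoyant_algorithm_def)
      also have "\<dots> = (\<Sum>g\<in>?G. ennreal (\<Prod>j<n. ?w (g j)) * expected_cost M (?I g))"
      proof -
        have meas: "(\<lambda>A. total_flow_time (?I g) (A (?I g))) \<in> borel_measurable M" if "g \<in> ?G" for g
          using M valid[OF that] by (simp add: randomized_clairvoyant_algorithm_def)
        have "(\<integral>\<^sup>+ A. (\<Sum>g\<in>?G. ennreal (\<Prod>j<n. ?w (g j)) * total_flow_time (?I g) (A (?I g))) \<partial>M)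
          = (\<Sum>g\<in>?G. \<integral>\<^sup>+ A. ennreal (\<Prod>j<n. ?w (g j)) * total_flow_time (?I g) (A (?I g)) \<partial>M)"
          using meas by (intro nn_integral_sum borel_measurable_times_ennreal) auto
        also have "\<dots> = (\<Sum>g\<in>?G. ennreal (\<Prod>j<n. ?w (g j)) * expected_cost M (?I g))"
          unfolding expected_cost_def by (intro sum.cong nn_integral_cmult meas refl)
        finally show ?thesis .
      qed
      also have "\<dots> \<le> (\<Sum>g\<in>?G. ennreal (\<Prod>j<n. ?w (g j)) * ennreal (\<rho> * u g))"
      proof (intro sum_mono mult_left_mono)
        fix g assume g: "g \<in> ?G"
        have "expected_cost M (?I g) \<le> ennreal \<rho> * opt_flow_time (?I g)"
          using comp valid[OF g] by (simp add: competitive_def)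
        also have "\<dots> \<le> ennreal \<rho> * ennreal (u g)"
          unfolding u_def c_def by (intro mult_left_mono batch_opt_le[OF Q n \<mu>0 g \<tau>_def h_def]) auto
        finally show "expected_cost M (?I g) \<le> ennreal (\<rho> * u g)" using \<rho> u0 by (simp add: ennreal_mult)
      qed auto
      also have "\<dots> = ennreal (?E (\<lambda>g. \<rho> * u g))"
        by (rule ennreal_prod_expectation[symmetric, OF w0]) (use \<rho> u0 in auto)
      also have "\<dots> = ennreal (\<rho> * (c + real N * (2 * (real n * Q + v / Q\<^sup>2 + 1))))"
        by (simp only: prod_expectation_cmult Eu)
      finally show ?thesis using \<rho> c0 v0 Q by (subst (asm) ennreal_le_iff) auto
    qed
    from le_of_affine_bounds[OF this] have "2 * real n - \<tau> \<le> \<rho> * (2 * (real n * Q + v / Q\<^sup>2 + 1))" .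
    moreover have "2 * real n - \<tau> = real n * (real r * Q)" by (simp add: \<tau>_def \<mu> algebra_simps)
    ultimately show ?thesis by (simp add: algebra_simps)
  qed
  from le_of_affine_bounds[OF this] have "Q * real r \<le> Q * (2 * \<rho>)" by (simp add: algebra_simps)
  then have "real r \<le> 2 * \<rho>" using Q by (simp only: mult_le_cancel_left_pos)
  then show ?thesis by simp
qed

section \<open>The trivial bound, and passage to the competitive ratio\<close>

text \<open>Serves the cases \<open>\<epsilon> = 1\<close> and \<open>r = 1\<close>, which the
  constructions above exclude. A single unit job has optimal flow time exactly 1, so a cost never
  below the optimum forces ratio 1.\<close>

lemma competitive_ge_1:
  assumes comp: "competitive (ennreal \<rho>) cost" and \<rho>: "0 \<le> \<rho>"
    and ge: "\<And>I. valid_instance I \<Longrightarrow> opt_flow_time I \<le> cost I"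
  shows "1 \<le> \<rho>"
proof -
  define I where "I = batch 1 (\<lambda>_. 1)"
  have I: "valid_instance I" unfolding I_def by (rule batch_valid) simp
  have "opt_flow_time I \<le> ennreal (\<Sum>j\<in>jobs I. 0 + proc_time I j - release I j)"
    by (rule opt_flow_time_le_nonpreemptive[OF I]) (auto simp: I_def batch_def)
  then have le: "opt_flow_time I \<le> 1" by (simp add: I_def batch_def)
  have ge1: "1 \<le> opt_flow_time I"
    unfolding opt_flow_time_def
  proof (rule Inf_greatest, clarify)
    fix S assume S: "valid_schedule I S"
    have "1 \<le> completion_time I S 0"
      unfolding completion_time_def
    proof (rule Inf_greatest, clarify)
      fix t assume t: "0 \<le> t" "proc_time I 0 \<le> processed S 0 t"
      have "processed S 0 t \<le> t" using sum_processed_le[OF S t(1), of "{0}"] by simp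
      then show "1 \<le> ennreal t" using t by (simp add: I_def batch_def)
    qed
    then show "1 \<le> total_flow_time I S" by (simp add: total_flow_time_def I_def batch_def)
  qed
  have "1 \<le> cost I" using ge1 ge[OF I] by (rule order.trans)
  also have "\<dots> \<le> ennreal \<rho> * opt_flow_time I" using comp I by (simp add: competitive_def)
  also have "\<dots> = ennreal \<rho>" using le ge1 by (simp add: antisym[OF le ge1])
  finally show ?thesis using \<rho> by simp
qed

lemma opt_le_algorithm_cost:
  "clairvoyant_algorithm \<epsilon> A \<Longrightarrow> valid_instance I \<Longrightarrow> opt_flow_time I \<le> algorithm_cost A I"
  unfolding algorithm_cost_def by (intro opt_le_total_flow_time clairvoyant_valid_schedule)

lemma opt_le_expected_cost:
  assumes M: "randomized_clairvoyant_algorithm \<epsilon> M" and I: "valid_instance I"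
  shows "opt_flow_time I \<le> expected_cost M I"
proof -
  interpret prob_space M using M by (simp add: randomized_clairvoyant_algorithm_def)
  have "opt_flow_time I = (\<integral>\<^sup>+ A. opt_flow_time I \<partial>M)" by (simp add: emeasure_space_1)
  also have "\<dots> \<le> expected_cost M I"
    unfolding expected_cost_def using M I
    by (intro nn_integral_mono opt_le_total_flow_time)
       (auto simp: randomized_clairvoyant_algorithm_def clairvoyant_valid_schedule)
  finally show ?thesis .
qed

text \<open>The infimum ranges over extended reals; an infinite ratio exceeds any real bound, so
  real ratios suffice.\<close>

lemma competitive_ratio_ge:
  assumes "\<And>\<rho>. 0 \<le> \<rho> \<Longrightarrow> competitive (ennreal \<rho>) cost \<Longrightarrow> b \<le> \<rho>"
  shows "ennreal b \<le> competitive_ratio cost"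
  unfolding competitive_ratio_def
proof (rule Inf_greatest, clarify)
  fix \<rho> assume "competitive \<rho> cost"
  then show "ennreal b \<le> \<rho>" using assms by (cases \<rho>) (auto intro: ennreal_leI)
qed

theorem theorem1p3:
  shows "(\<forall>\<epsilon>::real. 0 < \<epsilon> \<and> \<epsilon> \<le> 1 \<longrightarrow>
            (\<forall>A. clairvoyant_algorithm \<epsilon> A \<longrightarrow>
               ennreal (real_of_int \<lceil>1 / \<epsilon>\<rceil>) \<le> competitive_ratio (algorithm_cost A))) \<and>
         (\<exists>c::real. 0 < c \<and> (\<forall>\<epsilon>::real. 0 < \<epsilon> \<and> \<epsilon> \<le> 1 \<longrightarrow>
            (\<forall>M. randomized_clairvoyant_algorithm \<epsilon> M \<longrightarrow>
               ennreal (c / \<epsilon>) \<le> competitive_ratio (expected_cost M))))"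
proof (intro conjI allI impI exI[of _ "1/4 :: real"]; (elim conjE)?)
  fix \<epsilon> :: real and A assume \<epsilon>: "0 < \<epsilon>" "\<epsilon> \<le> 1" and A: "clairvoyant_algorithm \<epsilon> A"
  show "ennreal (real_of_int \<lceil>1 / \<epsilon>\<rceil>) \<le> competitive_ratio (algorithm_cost A)"
  proof (rule competitive_ratio_ge)
    fix \<rho> assume \<rho>: "0 \<le> \<rho>" and comp: "competitive (ennreal \<rho>) (algorithm_cost A)"
    show "real_of_int \<lceil>1 / \<epsilon>\<rceil> \<le> \<rho>"
    proof (cases "\<epsilon> = 1")
      case True
      then show ?thesis using competitive_ge_1[OF comp \<rho> opt_le_algorithm_cost[OF A]] by simp
    next
      case False
      define k where "k = nat \<lceil>1 / \<epsilon>\<rceil>"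
      have gt: "1 < 1 / \<epsilon>" using \<epsilon> False by simp
      then have ceil: "2 \<le> \<lceil>1 / \<epsilon>\<rceil>" by linarith
      have k: "real k = real_of_int \<lceil>1 / \<epsilon>\<rceil>" "2 \<le> k" unfolding k_def using ceil by linarith+
      have "real k - 1 < 1 / \<epsilon>" unfolding k by linarith
      then have "(real k - 1) * \<epsilon> < 1" using \<epsilon> by (simp add: field_simps)
      then have "real k \<le> \<rho>" using deterministic_lower_bound[OF A _ _ k(2) _ comp \<rho>] \<epsilon> False by simp
      then show ?thesis by (simp add: k)
    qed
  qed
next
  fix \<epsilon> :: real and M assume \<epsilon>: "0 < \<epsilon>" "\<epsilon> \<le> 1" and M: "randomized_clairvoyant_algorithm \<epsilon> M"
  show "ennreal (1 / 4 / \<epsilon>) \<le> competitive_ratio (expected_cost M)"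
  proof (rule competitive_ratio_ge)
    fix \<rho> assume \<rho>: "0 \<le> \<rho>" and comp: "competitive (ennreal \<rho>) (expected_cost M)"
    define r where "r = nat \<lfloor>1 / \<epsilon>\<rfloor>"
    have "1 \<le> 1 / \<epsilon>" using \<epsilon> by simp
    then have fl: "1 \<le> \<lfloor>1 / \<epsilon>\<rfloor>" by linarith
    have r: "real r = real_of_int \<lfloor>1 / \<epsilon>\<rfloor>" unfolding r_def using fl by linarith
    have r1: "1 \<le> real r" unfolding r using fl by simp
    have r2: "real r \<le> 1 / \<epsilon>" "1 / \<epsilon> < real r + 1" unfolding r by linarith+
    \<comment> \<open>Rounding loses at most a factor 2 and \<open>randomized_lower_bound\<close>
      another one, hence the constant 1/4.\<close>
    have half: "1 / \<epsilon> \<le> 2 * real r" using r1 r2 by linarith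
    show "1 / 4 / \<epsilon> \<le> \<rho>"
    proof (cases "2 \<le> r")
      case True
      have "real r * \<epsilon> \<le> 1" using r2 \<epsilon> by (simp add: field_simps)
      then have "real r / 2 \<le> \<rho>" using randomized_lower_bound[OF M \<epsilon>(1) _ True comp \<rho>] by simp
      then show ?thesis using half by simp
    next
      case False
      \<comment> \<open>Here \<open>r = 1\<close>, and the claimed bound is at most 1/2.\<close>
      then have "1 / \<epsilon> \<le> 2" using half r1 by simp
      then show ?thesis using competitive_ge_1[OF comp \<rho> opt_le_expected_cost[OF M]] by simp
    qed
  qed
qed simp

end
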